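(* Let $F:X\to X$ be a hemicontinuous and monotone operator, let $\bar x\in X$, and let $x^\dagger$ be the $\bar x$-minimum-norm solution of $F(x)=y$. Let $A\in\mathcal{L}(X,X)$ satisfy $$\langle Ax,x\rangle\ge0\quad\text{for all }x\in X,\qquad \overline{\mathcal{R}(A)}=X .$$ Assume there are $\rho>0$, $0<c<1$ and a monotonically increasing function $\sigma:\mathbb{R}^+\to\mathbb{R}^+$ such that for every $x\in\mathcal{B}_\rho(x^\dagger)$ there are $M(x)\in\mathcal{L}(X,X)$ and $N(x)\in X$ with $$F(x)-F(x^\dagger)=A\,M(x)(x-x^\dagger)+N(x),\quad \|M(x)-I\|\le c<1,\quad \|N(x)\|\le\sigma(\|x-x^\dagger\|).$$ Assume that $\sigma(e)\le C_\sigma\,e\,\varepsilon^{-1}(e)$ for some constant $C_\sigma>0$, where $\varepsilon$ is the function defined in the context. If $N\not\equiv0$, assume additionally that for all $x,\tilde x\in\mathcal{B}_\rho(x^\dagger)$ $$\|M(x)-M(\tilde x)\|\le L_M\|x-\tilde x\|,\qquad \langle AM(x)h,h\rangle\ge0\ \text{ for all }h\in X,$$ and that $$\|x^\dagger-\bar x\|\le(1-c)\rho,\qquad c+\rho L_M<1 .$$ Let $\alpha=\alpha(\delta)$ be chosen a priori such that, for some sufficiently large constant $\tau>1$ (the same $\tau$ as in the definition of $\varepsilon$), $$\delta\le\tau\,\phi(\alpha)\ \text{ and }\ d(\chi^{-1}(\alpha))\le\tau\,d(\chi^{-1}(\phi^{-1}(\delta)))\quad\text{if }x^\dagger-\bar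 x\notin\mathcal{R}(A),$$ $$\tfrac1\tau\,\delta\le\alpha^2\le\tau\,\delta\quad\text{if }x^\dagger-\bar x=Aw\text{ for some }w\in X .$$ Then, as $\delta\to0$, $$\|x_\alpha^\delta-x^\dagger\|=\begin{cases}O\big(d(\chi^{-1}(\phi^{-1}(\delta)))\big)&\text{if }x^\dagger-\bar x\notin\mathcal{R}(A),\\ O(\sqrt\delta)&\text{if }x^\dagger-\bar x=Aw\text{ for some }w\in X.\end{cases}$$ In particular, if $F$ is Gâteaux differentiable with locally Lipschitz continuous derivative, $\|F'(x)-F'(x^\dagger)\|\le L\|x-x^\dagger\|$ for all $x\in\mathcal{B}_\rho(x^\dagger)$, and $x^\dagger-\bar x=Aw$ for some $w\in X$ holds with $A=F'(x^\dagger)$, then $\|x_\alpha^\delta-x^\dagger\|=O(\sqrt\delta)$.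
   Context: $X$ is an infinite dimensional separable real Hilbert space with norm $\|\cdot\|$ and inner product $\langle\cdot,\cdot\rangle$; $\mathcal{L}(X,X)$ denotes the bounded linear operators on $X$, $\mathcal{R}(A)$ the range of $A$, $\mathcal{B}_\rho(x^\dagger)$ the ball of radius $\rho$ around $x^\dagger$. $F:X\to X$ is monotone if $\langle F(x)-F(\tilde x),x-\tilde x\rangle\ge 0$ for all $x,\tilde x\in X$; hemicontinuous means that for all $x,h,z\in X$ the map $t\mapsto\langle F(x+th),z\rangle$ is continuous on $\mathbb{R}$. The solution set $L=\{x: F(x)=y\}$ is assumed nonempty (it is convex and closed), and the $\bar x$-minimum-norm solution is the element of $L$ of minimal distance to $\bar x$. For $\alpha>0$, $\delta>0$ and noisy data $y^\delta\in X$ with $\|y-y^\delta\|\le\delta$, the (Lavrentiev) regularized solution $x_\alpha^\delta\in X$ is the unique solution of $$F(x_\alpha^\delta)+\alpha(x_\alpha^\delta-\bar x)=y^\delta .$$ Auxiliary functions: for $R>0$ let $$d(R)=\min\{\|x^\dagger-\bar x-Aw\|:\ w\in X,\ \|w\|\le R\},\qquad \chi(R)=\frac{d(R)}{R},\qquad \phi(\alpha)=\alpha\,d(\chi^{-1}(\alpha)).$$ If $x^\dagger-\bar x\notin\mathcal{R}(A)$, then since $\overline{\mathcal{R}(A)}=X$ the function $d$ is continuous, positive, convex and strictly decreasing to zero as $R\to\infty$. With a constant $\tau>1$, $$\varepsilon(\alpha)=\begin{cases}\left(\frac{2-c}{1-c}+\tau\right)d(\chi^{-1}(\alpha))&\text{if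 }x^\dagger-\bar x\notin\mathcal{R}(A),\\[1ex] \left(\frac{\|w\|}{1-c}+\tau\right)\alpha&\text{if }x^\dagger-\bar x=Aw,\ w\in X.\end{cases}$$ *)

theory Defs
  imports "HOL-Analysis.Analysis" "HOL-Library.Landau_Symbols"
begin

definition monotone_operator :: "('a::real_inner \<Rightarrow> 'a) \<Rightarrow> bool" where
  "monotone_operator F \<longleftrightarrow> (\<forall>x x'. 0 \<le> (F x - F x') \<bullet> (x - x'))"

definition hemicontinuous :: "('a::real_inner \<Rightarrow> 'a) \<Rightarrow> bool" where
  "hemicontinuous F \<longleftrightarrow> (\<forall>x h z. continuous_on UNIV (\<lambda>t::real. F (x + t *\<^sub>R h) \<bullet> z))"

definition min_norm_solution :: "('a::real_inner \<Rightarrow> 'a) \<Rightarrow> 'a \<Rightarrow> 'a \<Rightarrow> 'a \<Rightarrow> bool" where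
  "min_norm_solution F y xbar xdag \<longleftrightarrow>
     F xdag = y \<and> (\<forall>x. F x = y \<longrightarrow> norm (xdag - xbar) \<le> norm (x - xbar))"

text \<open>For monotone hemicontinuous \<open>F\<close> and \<open>\<alpha> > 0\<close> there is exactly one such \<open>x\<close>
  for each datum \<open>yd\<close>.\<close>

definition lavrentiev_solution :: "('a::real_inner \<Rightarrow> 'a) \<Rightarrow> 'a \<Rightarrow> real \<Rightarrow> 'a \<Rightarrow> 'a \<Rightarrow> bool" where
  "lavrentiev_solution F xbar \<alpha> yd x \<longleftrightarrow> F x + \<alpha> *\<^sub>R (x - xbar) = yd"

definition gateaux_derivative ::
    "('a::real_normed_vector \<Rightarrow> 'a) \<Rightarrow> 'a \<Rightarrow> ('a \<Rightarrow>\<^sub>L 'a) \<Rightarrow> bool" where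
  "gateaux_derivative F x D \<longleftrightarrow>
     (\<forall>h. ((\<lambda>t::real. F (x + t *\<^sub>R h)) has_vector_derivative blinfun_apply D h) (at 0))"

text \<open>In the functions below \<open>g\<close> plays the role of \<open>xdag - xbar\<close>. In a Hilbert space the infimum
  defining \<open>dist_fun\<close> is attained for \<open>R \<ge> 0\<close>, since \<open>cball 0 R\<close> is weakly compact.\<close>

definition dist_fun :: "('a::real_inner \<Rightarrow>\<^sub>L 'a) \<Rightarrow> 'a \<Rightarrow> real \<Rightarrow> real" where
  "dist_fun A g R = (INF w\<in>cball 0 R. norm (g - blinfun_apply A w))"

definition chi :: "('a::real_inner \<Rightarrow>\<^sub>L 'a) \<Rightarrow> 'a \<Rightarrow> real \<Rightarrow> real" where
  "chi A g R = dist_fun A g R / R"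

text \<open>Inverses are inverses of functions on \<open>{0<..}\<close>. If \<open>range A\<close> is dense and
  does not contain \<open>g\<close>, then \<open>chi A g\<close> and \<open>phi A g\<close> are bijections of \<open>{0<..}\<close> onto itself,
  whereas \<open>eps\<close> is injective on \<open>{0<..}\<close> with bounded image.\<close>

definition chi_inv :: "('a::real_inner \<Rightarrow>\<^sub>L 'a) \<Rightarrow> 'a \<Rightarrow> real \<Rightarrow> real" where
  "chi_inv A g = the_inv_into {0<..} (chi A g)"

definition phi :: "('a::real_inner \<Rightarrow>\<^sub>L 'a) \<Rightarrow> 'a \<Rightarrow> real \<Rightarrow> real" where
  "phi A g \<alpha> = \<alpha> * dist_fun A g (chi_inv A g \<alpha>)"

definition phi_inv :: "('a::real_inner \<Rightarrow>\<^sub>L 'a) \<Rightarrow> 'a \<Rightarrow> real \<Rightarrow> real" where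
  "phi_inv A g = the_inv_into {0<..} (phi A g)"

text \<open>The description of the source element is proper: if \<open>A h \<bullet> h \<ge> 0\<close> for all \<open>h\<close> and
  \<open>range A\<close> is dense, then \<open>A\<close> is injective.\<close>

definition eps :: "('a::real_inner \<Rightarrow>\<^sub>L 'a) \<Rightarrow> 'a \<Rightarrow> real \<Rightarrow> real \<Rightarrow> real \<Rightarrow> real" where
  "eps A g c \<tau> \<alpha> =
     (if g \<notin> range (blinfun_apply A)
      then ((2 - c) / (1 - c) + \<tau>) * dist_fun A g (chi_inv A g \<alpha>)
      else (norm (THE w. g = blinfun_apply A w) / (1 - c) + \<tau>) * \<alpha>)"

definition eps_inv :: "('a::real_inner \<Rightarrow>\<^sub>L 'a) \<Rightarrow> 'a \<Rightarrow> real \<Rightarrow> real \<Rightarrow> real \<Rightarrow> real" where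
  "eps_inv A g c \<tau> = the_inv_into {0<..} (eps A g c \<tau>)"

end

theory Submission
  imports Defs
begin

text \<open>
  Write \<open>g = xdag - xbar\<close> and let \<open>x\<close> be the regularized solution. As \<open>F\<close> is monotone,
  \<open>F + \<alpha> I\<close> is strongly monotone with constant \<open>\<alpha>\<close>, so that \<open>x\<close> lies within
  \<open>s/\<alpha>\<close> of every point that satisfies the regularized equation up to a residual of norm \<open>s\<close>.
  The proof therefore looks for a point close to \<open>xdag\<close> that almost solves the equation.

  Such a point is the solution \<open>z\<close> of \<open>A M(z) (z - xdag) + \<alpha> (z - xbar) = 0\<close>. By the structure
  condition its residual has norm at most \<open>\<delta> + \<parallel>N z\<parallel>\<close>. It is found as a fixed point: the equation
  with frozen \<open>M\<close> is solvable because \<open>A M\<close> is accretive (\<open>accretive_resolvent_exists\<close>), and the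
  smallness conditions make the solution a contractive function of the frozen argument
  (\<open>comparison_element_exists\<close>). The central
  estimate is \<open>comparison_element_bound\<close>: splitting \<open>g = A w + (g - A w)\<close> gives
  \<open>\<parallel>z - xdag\<parallel> \<le> \<alpha> \<parallel>w\<parallel> / (1 - c) + \<parallel>g - A w\<parallel>\<close>, where the first term comes from testing the
  equation for its part \<open>e\<close> driven by \<open>A w\<close> with \<open>M e + \<alpha> w\<close>. With \<open>\<parallel>w\<parallel> \<le> R\<close>, the right-hand side
  becomes \<open>\<alpha> R / (1 - c) + d R\<close>, and \<open>R = chi_inv \<alpha>\<close> makes \<open>\<alpha> R = d R\<close>. The sum is then
  at most \<open>eps \<alpha>\<close>, so the growth condition gives
  \<open>\<parallel>N z\<parallel> \<le> \<sigma> (eps \<alpha>) \<le> C\<^sub>\<sigma> \<alpha> eps \<alpha>\<close>; after division by \<open>\<alpha>\<close> the residual contributes the same order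
  as the bound on \<open>\<parallel>z - xdag\<parallel>\<close>. The parameter choice turns this order, and the
  noise term \<open>\<delta>/\<alpha>\<close>, into the asserted rate.

  If \<open>N\<close> vanishes on the ball, \<open>A M(x)\<close> may fail to be accretive, and \<open>z\<close> may fail to exist. But then
  the structure condition applies to \<open>x\<close> itself, and the same test element bounds \<open>x - xdag\<close> directly
  (\<open>direct_error_bound\<close>), once \<open>x\<close> is known to lie in the ball. That
  is the norm convergence of the regularized solutions to the minimum-norm solution
  (\<open>lavrentiev_tendsto\<close>), obtained from monotonicity without weak compactness.

  The two cases of the source condition enter only through the pair \<open>(R, D)\<close> in
  \<open>lavrentiev_rate\<close>: it is \<open>(chi_inv \<alpha>, d (chi_inv \<alpha>))\<close> if \<open>g\<close> is outside the range of \<open>A\<close>, and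
  \<open>(\<parallel>w\<parallel>, 0)\<close> if \<open>g = A w\<close>. The differentiable case freezes the derivative at \<open>xdag\<close>: then
  \<open>z - xdag\<close> solves a linear equation and is of order \<open>\<alpha>\<close>, so \<open>z\<close> enters the ball for small
  \<open>\<alpha>\<close> without a condition that relates \<open>g\<close> to the radius.
\<close>

section \<open>Linear equations with an accretive operator\<close>

text \<open>For \<open>s = \<kappa>/K\<^sup>2\<close>, where \<open>K\<close> bounds both \<open>norm B\<close> and \<open>\<kappa>\<close>, the damped iteration
  \<open>z \<mapsto> z - s (B z - b)\<close> contracts, since
  \<open>\<parallel>z - s B z\<parallel>\<^sup>2 \<le> (1 - 2 s \<kappa> + s\<^sup>2 K\<^sup>2) \<parallel>z\<parallel>\<^sup>2 = (1 - \<kappa>\<^sup>2/K\<^sup>2) \<parallel>z\<parallel>\<^sup>2\<close>. This is the Lax-Milgram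
  lemma for bilinear forms given by an operator.\<close>

lemma coercive_operator_surj:
  fixes B :: "'a::{real_inner,complete_space} \<Rightarrow>\<^sub>L 'a"
  assumes \<kappa>: "\<kappa> > 0" and coercive: "\<And>x. \<kappa> * (norm x)\<^sup>2 \<le> blinfun_apply B x \<bullet> x"
  shows "\<exists>x. blinfun_apply B x = b"
proof -
  define K where "K = norm B + \<kappa>"
  have K: "K > 0" "\<kappa> \<le> K" "norm B \<le> K"
    using \<kappa> by (auto simp: K_def add_nonneg_pos)
  define s where "s = \<kappa> / K\<^sup>2"
  have s: "s > 0" using \<kappa> K by (simp add: s_def)
  define q where "q = sqrt (1 - \<kappa>\<^sup>2 / K\<^sup>2)"
  have ratio: "0 < \<kappa>\<^sup>2 / K\<^sup>2" "\<kappa>\<^sup>2 / K\<^sup>2 \<le> 1"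
    using \<kappa> K power_mono[of \<kappa> K 2] by (auto simp: divide_simps)
  have q: "0 \<le> q" "q < 1" "q\<^sup>2 = 1 - \<kappa>\<^sup>2 / K\<^sup>2"
    using ratio by (auto simp: q_def)
  define T where "T = (\<lambda>z. z - s *\<^sub>R (blinfun_apply B z - b))"
  have lin: "norm (z - s *\<^sub>R blinfun_apply B z) \<le> q * norm z" for z
  proof -
    have "(norm (blinfun_apply B z))\<^sup>2 \<le> K\<^sup>2 * (norm z)\<^sup>2"
      using order_trans[OF norm_blinfun mult_right_mono[OF K(3) norm_ge_zero]]
      by (metis norm_ge_zero power_mono power_mult_distrib)
    then have "s\<^sup>2 * (norm (blinfun_apply B z))\<^sup>2 \<le> s\<^sup>2 * (K\<^sup>2 * (norm z)\<^sup>2)"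
      by (simp add: mult_left_mono)
    moreover have "2 * s * (\<kappa> * (norm z)\<^sup>2) \<le> 2 * s * (blinfun_apply B z \<bullet> z)"
      using coercive[of z] s by simp
    moreover have "(norm (z - s *\<^sub>R blinfun_apply B z))\<^sup>2
        = (norm z)\<^sup>2 - 2 * s * (blinfun_apply B z \<bullet> z) + s\<^sup>2 * (norm (blinfun_apply B z))\<^sup>2"
      unfolding power2_norm_eq_inner
      by (simp add: inner_diff_left inner_diff_right inner_commute power2_eq_square algebra_simps)
    ultimately have "(norm (z - s *\<^sub>R blinfun_apply B z))\<^sup>2
        \<le> (norm z)\<^sup>2 - 2 * s * (\<kappa> * (norm z)\<^sup>2) + s\<^sup>2 * (K\<^sup>2 * (norm z)\<^sup>2)"
      by linarith
    also have "\<dots> = (q * norm z)\<^sup>2"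
      using K unfolding power_mult_distrib q(3) s_def
      by (simp add: field_simps power2_eq_square)
    finally show ?thesis
      using q by (meson mult_nonneg_nonneg norm_ge_zero power2_le_imp_le)
  qed
  have "dist (T z) (T z') \<le> q * dist z z'" for z z'
  proof -
    have "T z - T z' = (z - z') - s *\<^sub>R blinfun_apply B (z - z')"
      by (simp add: T_def blinfun.diff_right algebra_simps)
    then show ?thesis using lin[of "z - z'"] by (simp add: dist_norm)
  qed
  then obtain x where "T x = x"
    using banach_fix_type[OF q(1,2), of T] by blast
  then show ?thesis using s by (auto simp: T_def)
qed

lemma accretive_resolvent_exists:
  fixes B :: "'a::{real_inner,complete_space} \<Rightarrow>\<^sub>L 'a"
  assumes acc: "\<And>x. 0 \<le> blinfun_apply B x \<bullet> x" and \<alpha>: "\<alpha> > 0"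
  shows "\<exists>e. blinfun_apply B e + \<alpha> *\<^sub>R e = b"
proof -
  have "\<exists>e. blinfun_apply (B + \<alpha> *\<^sub>R id_blinfun) e = b"
  proof (rule coercive_operator_surj[OF \<alpha>])
    show "\<alpha> * (norm x)\<^sup>2 \<le> blinfun_apply (B + \<alpha> *\<^sub>R id_blinfun) x \<bullet> x" for x
      using acc[of x]
      by (simp add: plus_blinfun.rep_eq scaleR_blinfun.rep_eq inner_add_left power2_norm_eq_inner)
  qed
  then show ?thesis by (simp add: plus_blinfun.rep_eq scaleR_blinfun.rep_eq)
qed

lemma accretive_resolvent_contraction:
  fixes B :: "'a::real_inner \<Rightarrow>\<^sub>L 'a"
  assumes acc: "\<And>x. 0 \<le> blinfun_apply B x \<bullet> x" and \<alpha>: "\<alpha> > 0"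
    and eq: "blinfun_apply B e + \<alpha> *\<^sub>R e = \<alpha> *\<^sub>R r"
  shows "norm e \<le> norm r"
proof -
  have "blinfun_apply B e = \<alpha> *\<^sub>R (r - e)"
    using eq by (simp add: algebra_simps)
  then have "0 \<le> \<alpha> * ((r - e) \<bullet> e)" using acc[of e] by simp
  then have "e \<bullet> e \<le> r \<bullet> e"
    using \<alpha> by (simp add: zero_le_mult_iff inner_diff_left)
  also have "\<dots> \<le> norm r * norm e" by (rule norm_cauchy_schwarz)
  finally have "norm e * norm e \<le> norm r * norm e"
    by (simp add: norm_eq_sqrt_inner)
  then show ?thesis
    by (cases "e = 0") auto
qed

lemma inner_near_identity:
  fixes M :: "'a::real_inner \<Rightarrow>\<^sub>L 'a"
  assumes "norm (M - id_blinfun) \<le> c"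
  shows "(1 - c) * (norm z)\<^sup>2 \<le> z \<bullet> blinfun_apply M z"
    and "norm (blinfun_apply M z) \<le> (1 + c) * norm z"
proof -
  have d: "blinfun_apply M z = z + blinfun_apply (M - id_blinfun) z"
    by (simp add: minus_blinfun.rep_eq)
  have n: "norm (blinfun_apply (M - id_blinfun) z) \<le> c * norm z"
    using order_trans[OF norm_blinfun mult_right_mono[OF assms norm_ge_zero]] .
  have "- (z \<bullet> blinfun_apply (M - id_blinfun) z) \<le> norm z * (c * norm z)"
    using Cauchy_Schwarz_ineq2[of z "blinfun_apply (M - id_blinfun) z"]
      mult_left_mono[OF n, of "norm z"] by simp
  then show "(1 - c) * (norm z)\<^sup>2 \<le> z \<bullet> blinfun_apply M z"
    unfolding d by (simp add: inner_add_right power2_norm_eq_inner[symmetric] algebra_simps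
      power2_eq_square)
  have "norm (z + blinfun_apply (M - id_blinfun) z) \<le> norm z + c * norm z"
    using n norm_triangle_ineq[of z "blinfun_apply (M - id_blinfun) z"] by linarith
  then show "norm (blinfun_apply M z) \<le> (1 + c) * norm z"
    unfolding d by (simp add: algebra_simps)
qed

text \<open>The bound does not involve \<open>\<alpha>\<close> or an inverse of \<open>A\<close>: the equation says
  \<open>A (M z - v) = - \<alpha> z\<close>, so accretivity at \<open>M z - v\<close> yields \<open>\<langle>z, M z\<rangle> \<le> \<langle>z, v\<rangle>\<close>, and \<open>M\<close> is close
  to the identity. It serves both for the part \<open>A w\<close> of the source (with \<open>v = - \<alpha> w\<close>) and for
  the Lipschitz dependence of the comparison element on the frozen argument.\<close>

lemma resolvent_of_smoothed_bound:
  fixes A M :: "'a::real_inner \<Rightarrow>\<^sub>L 'a"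
  assumes acc: "\<And>x. 0 \<le> blinfun_apply A x \<bullet> x" and \<alpha>: "\<alpha> > 0"
    and M: "norm (M - id_blinfun) \<le> c"
    and eq: "blinfun_apply A (blinfun_apply M z) + \<alpha> *\<^sub>R z = blinfun_apply A v"
  shows "(1 - c) * norm z \<le> norm v"
proof -
  define u where "u = blinfun_apply M z - v"
  have "blinfun_apply A u = - (\<alpha> *\<^sub>R z)"
    using eq by (simp add: u_def blinfun.diff_right algebra_simps)
  then have "\<alpha> * (z \<bullet> u) \<le> 0" using acc[of u] by simp
  then have "z \<bullet> blinfun_apply M z \<le> z \<bullet> v"
    using \<alpha> by (simp add: mult_le_0_iff u_def inner_diff_right)
  then have "(1 - c) * (norm z)\<^sup>2 \<le> norm z * norm v"
    using inner_near_identity(1)[OF M, of z] norm_cauchy_schwarz[of z v] by linarith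
  then have "norm z * ((1 - c) * norm z) \<le> norm z * norm v"
    by (simp add: power2_eq_square algebra_simps)
  then show ?thesis
    by (cases "z = 0") auto
qed

text \<open>Needed to identify the source element \<open>w\<close> of \<open>g = A w\<close> inside \<open>eps\<close>. If \<open>A u = 0\<close>, then
  \<open>\<langle>A (u + t h), u + t h\<rangle> = t \<langle>A h, u\<rangle> + t\<^sup>2 \<langle>A h, h\<rangle>\<close> is nonnegative for all real \<open>t\<close>, which forces
  the linear coefficient to vanish; hence \<open>u\<close> is orthogonal to the dense range.\<close>

lemma accretive_dense_range_inj:
  fixes A :: "'a::real_inner \<Rightarrow>\<^sub>L 'a"
  assumes acc: "\<And>x. 0 \<le> blinfun_apply A x \<bullet> x"
    and dense: "closure (range (blinfun_apply A)) = UNIV"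
    and eq: "blinfun_apply A v = blinfun_apply A w"
  shows "v = w"
proof -
  define u where "u = v - w"
  have Au: "blinfun_apply A u = 0" using eq by (simp add: u_def blinfun.diff_right)
  have le: "0 \<le> blinfun_apply A h \<bullet> u" for h
  proof (rule ccontr)
    assume "\<not> ?thesis"
    then have neg: "blinfun_apply A h \<bullet> u < 0" by simp
    define b where "b = blinfun_apply A h \<bullet> u"
    define a where "a = blinfun_apply A h \<bullet> h"
    have a: "a \<ge> 0" using acc by (simp add: a_def)
    have "0 \<le> t * b + t\<^sup>2 * a" for t
      using acc[of "u + t *\<^sub>R h"] Au
      by (simp add: blinfun.add_right blinfun.scaleR_right inner_add_right a_def b_def
          power2_eq_square algebra_simps)
    \<comment> \<open>A value of the parameter for which the quadratic polynomial is negative; the summand \<open>1\<close> keeps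
      the denominator positive if \<open>a = 0\<close>.\<close>
    from this[of "- b / (a + 1)"] have "0 \<le> - (b\<^sup>2) / (a+1) + b\<^sup>2 * a / (a+1)\<^sup>2"
      by (simp add: power_divide power2_eq_square)
    also have "\<dots> = - (b\<^sup>2) / (a+1)\<^sup>2"
      using a by (simp add: divide_simps) (simp add: power2_eq_square algebra_simps)
    also have "\<dots> < 0" using neg a by (simp add: b_def)
    finally show False by simp
  qed
  have orth: "blinfun_apply A h \<bullet> u = 0" for h
    using le[of h] le[of "- h"] by (simp add: blinfun.minus_right)
  have "closed {x. x \<bullet> u = 0}" by (intro closed_Collect_eq continuous_intros)
  then have "closure (range (blinfun_apply A)) \<subseteq> {x. x \<bullet> u = 0}"
    by (intro closure_minimal) (auto simp: orth)
  then have "u \<in> {x. x \<bullet> u = 0}" using dense by blast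
  then show ?thesis by (simp add: u_def)
qed

section \<open>Comparison element and error bounds\<close>

text \<open>The map sends \<open>x\<close> to the solution of the linear equation with \<open>M\<close> frozen at \<open>x\<close>. It stays
  within distance \<open>\<parallel>g\<parallel>\<close> of \<open>xdag\<close> by \<open>accretive_resolvent_contraction\<close>. The difference of two
  images solves a linear equation with right-hand side \<open>A (M x' - M x) (e x')\<close>, so
  \<open>resolvent_of_smoothed_bound\<close> gives the Lipschitz constant \<open>L \<parallel>g\<parallel> / (1 - c) \<le> \<rho> L\<close>.\<close>

lemma comparison_element_exists:
  fixes A :: "'a::{real_inner,complete_space} \<Rightarrow>\<^sub>L 'a" and M :: "'a \<Rightarrow> 'a \<Rightarrow>\<^sub>L 'a"
  assumes acc: "\<And>x. 0 \<le> blinfun_apply A x \<bullet> x" and \<alpha>: "\<alpha> > 0"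
    and c: "c < 1" and \<rho>: "\<rho> > 0"
    and M: "\<And>x. x \<in> S \<Longrightarrow> norm (M x - id_blinfun) \<le> c"
    and AM: "\<And>x h. x \<in> S \<Longrightarrow> 0 \<le> blinfun_apply A (blinfun_apply (M x) h) \<bullet> h"
    and lip: "\<And>x x'. x \<in> S \<Longrightarrow> x' \<in> S \<Longrightarrow> norm (M x - M x') \<le> L * norm (x - x')"
    and g: "norm g \<le> (1 - c) * \<rho>" and L: "\<rho> * L < 1"
    and S: "cball xdag (norm g) \<subseteq> S"
  shows "\<exists>x\<in>cball xdag (norm g).
           blinfun_apply A (blinfun_apply (M x) (x - xdag)) + \<alpha> *\<^sub>R (x - xdag + g) = 0"
proof -
  define D where "D = cball xdag (norm g)"
  have D: "complete D" "D \<noteq> {}" "xdag \<in> D"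
    unfolding D_def by (auto simp: complete_eq_closed)
  have "\<exists>e. blinfun_apply (A o\<^sub>L M x) e + \<alpha> *\<^sub>R e = - (\<alpha> *\<^sub>R g)" if "x \<in> S" for x
    using AM[OF that] by (intro accretive_resolvent_exists[OF _ \<alpha>]) simp
  then obtain e where e: "\<And>x. x \<in> S \<Longrightarrow>
      blinfun_apply (A o\<^sub>L M x) (e x) + \<alpha> *\<^sub>R e x = - (\<alpha> *\<^sub>R g)"
    by metis
  have e_bound: "norm (e x) \<le> norm g" if "x \<in> S" for x
  proof -
    have "norm (e x) \<le> norm (- g)"
      using e[OF that] AM[OF that]
      by (intro accretive_resolvent_contraction[OF _ \<alpha>, of "A o\<^sub>L M x"]) auto
    then show ?thesis by simp
  qed
  \<comment> \<open>\<open>L\<close> may be negative, whereas a contraction factor may not.\<close>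
  define q where "q = max 0 (\<rho> * L)"
  have q: "0 \<le> q" "q < 1" using L by (auto simp: q_def)
  have contr: "dist (xdag + e x) (xdag + e x') \<le> q * dist x x'"
    if "x \<in> D" "x' \<in> D" for x x'
  proof -
    have xS: "x \<in> S" "x' \<in> S" using that S by (auto simp: D_def)
    have "blinfun_apply A (blinfun_apply (M x) (e x - e x')) + \<alpha> *\<^sub>R (e x - e x')
        = blinfun_apply A (blinfun_apply (M x' - M x) (e x'))"
      using e[OF xS(1)] e[OF xS(2)]
      by (simp add: blinfun.diff_right minus_blinfun.rep_eq algebra_simps)
    from resolvent_of_smoothed_bound[OF acc \<alpha> M[OF xS(1)] this]
    have "(1 - c) * norm (e x - e x') \<le> norm (blinfun_apply (M x' - M x) (e x'))" .
    also have "\<dots> \<le> norm (M x' - M x) * norm (e x')" by (rule norm_blinfun)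
    also have "\<dots> \<le> norm (M x' - M x) * ((1 - c) * \<rho>)"
      using e_bound[OF xS(2)] g by (intro mult_left_mono) auto
    finally have "(1 - c) * norm (e x - e x') \<le> (1 - c) * (\<rho> * norm (M x' - M x))"
      by (simp add: mult_ac)
    then have "norm (e x - e x') \<le> \<rho> * norm (M x' - M x)" using c by simp
    also have "\<dots> \<le> \<rho> * (L * norm (x' - x))"
      using lip[OF xS(2,1)] \<rho> by (intro mult_left_mono) auto
    also have "\<dots> = (\<rho> * L) * norm (x - x')" by (simp add: norm_minus_commute)
    also have "\<dots> \<le> q * norm (x - x')"
      by (intro mult_right_mono) (auto simp: q_def)
    finally show ?thesis by (simp add: dist_norm)
  qed
  have "(\<lambda>x. xdag + e x) ` D \<subseteq> D"
    using e_bound S by (auto simp: D_def dist_norm)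
  then obtain x where x: "x \<in> D" "xdag + e x = x"
    using Banach_fix[OF D(1,2) q, of "\<lambda>x. xdag + e x"] contr by blast
  then have xS: "x \<in> S" and ex: "e x = x - xdag"
    using S by (auto simp: D_def algebra_simps)
  have "blinfun_apply A (blinfun_apply (M x) (x - xdag)) + \<alpha> *\<^sub>R (x - xdag + g) = 0"
    using e[OF xS] unfolding ex by (simp add: algebra_simps)
  then show ?thesis using x by (auto simp: D_def)
qed

text \<open>By linearity \<open>e\<close> is the sum of the response to \<open>- \<alpha> A w\<close>, controlled through the smoothing of
  \<open>A\<close>, and the response to \<open>- \<alpha> (g - A w)\<close>, which the resolvent does not enlarge.\<close>

lemma comparison_element_bound:
  fixes A :: "'a::{real_inner,complete_space} \<Rightarrow>\<^sub>L 'a" and M :: "'a \<Rightarrow>\<^sub>L 'a"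
  assumes acc: "\<And>x. 0 \<le> blinfun_apply A x \<bullet> x" and \<alpha>: "\<alpha> > 0"
    and c: "c < 1"
    and M: "norm (M - id_blinfun) \<le> c"
    and AM: "\<And>h. 0 \<le> blinfun_apply A (blinfun_apply M h) \<bullet> h"
    and e: "blinfun_apply A (blinfun_apply M e) + \<alpha> *\<^sub>R (e + g) = 0"
  shows "norm e \<le> \<alpha> * norm w / (1 - c) + norm (g - blinfun_apply A w)"
proof -
  have acc': "0 \<le> blinfun_apply (A o\<^sub>L M) x \<bullet> x" for x using AM by simp
  obtain e' where e': "blinfun_apply (A o\<^sub>L M) e' + \<alpha> *\<^sub>R e' = blinfun_apply A (- (\<alpha> *\<^sub>R w))"
    using accretive_resolvent_exists[OF acc' \<alpha>] by blast
  have "(1 - c) * norm e' \<le> norm (- (\<alpha> *\<^sub>R w))"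
    using e' by (intro resolvent_of_smoothed_bound[OF acc \<alpha> M]) simp
  then have 1: "norm e' \<le> \<alpha> * norm w / (1 - c)"
    using c \<alpha> by (simp add: field_simps)
  have "blinfun_apply (A o\<^sub>L M) (e - e') + \<alpha> *\<^sub>R (e - e') = \<alpha> *\<^sub>R (- (g - blinfun_apply A w))"
    using e e' by (simp add: blinfun.diff_right blinfun.minus_right blinfun.scaleR_right
        algebra_simps add_eq_0_iff2)
  from accretive_resolvent_contraction[OF acc' \<alpha> this]
  have 2: "norm (e - e') \<le> norm (g - blinfun_apply A w)" by (simp add: norm_minus_commute)
  show ?thesis using 1 2 norm_triangle_ineq[of e' "e - e'"] by simp
qed

lemma lavrentiev_stability:
  fixes F :: "'a::real_inner \<Rightarrow> 'a"
  assumes mono: "monotone_operator F" and \<alpha>: "\<alpha> > 0"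
    and x: "lavrentiev_solution F xbar \<alpha> yd x"
  shows "\<alpha> * norm (x - z) \<le> norm (yd - (F z + \<alpha> *\<^sub>R (z - xbar)))"
proof -
  define r where "r = yd - (F z + \<alpha> *\<^sub>R (z - xbar))"
  have "F x - F z = r - \<alpha> *\<^sub>R (x - z)"
    using x by (simp add: lavrentiev_solution_def r_def algebra_simps)
  moreover have "0 \<le> (F x - F z) \<bullet> (x - z)" using mono by (simp add: monotone_operator_def)
  ultimately have "\<alpha> * (norm (x - z))\<^sup>2 \<le> r \<bullet> (x - z)"
    by (simp add: inner_diff_left power2_norm_eq_inner)
  also have "\<dots> \<le> norm r * norm (x - z)" by (rule norm_cauchy_schwarz)
  finally have "(\<alpha> * norm (x - z)) * norm (x - z) \<le> norm r * norm (x - z)"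
    by (simp add: power2_eq_square mult.assoc)
  then show ?thesis
    by (cases "x = z") (auto simp: r_def)
qed

text \<open>\<open>A M\<close> may fail to be accretive, so the equation is tested with \<open>v = M e + \<alpha> w\<close>, for which
  \<open>A v\<close> is exactly what the equation expresses in terms of \<open>e\<close> and small data. This yields a
  quadratic inequality for \<open>\<parallel>e\<parallel>\<close>; the factor \<open>4\<close> comes from solving it crudely.\<close>

lemma direct_error_bound:
  fixes A M :: "'a::real_inner \<Rightarrow>\<^sub>L 'a"
  assumes acc: "\<And>x. 0 \<le> blinfun_apply A x \<bullet> x" and \<alpha>: "\<alpha> > 0"
    and c: "c < 1"
    and M: "norm (M - id_blinfun) \<le> c"
    and e: "blinfun_apply A (blinfun_apply M e) + \<alpha> *\<^sub>R (e + g) = \<eta>"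
  shows "norm e \<le> 4 / (1 - c) * (\<alpha> * norm w + norm \<eta> / \<alpha> + norm (g - blinfun_apply A w))"
proof -
  have c0: "0 \<le> c" using M norm_ge_zero order_trans by blast
  define E s t u where "E = norm e" and "s = \<alpha> * norm w"
    and "t = norm \<eta> / \<alpha> + norm (g - blinfun_apply A w)" and "u = s + t"
  have pos: "0 \<le> E" "0 \<le> s" "0 \<le> t" using \<alpha> by (auto simp: E_def s_def t_def)
  define v where "v = blinfun_apply M e + \<alpha> *\<^sub>R w"
  define k where "k = (1 / \<alpha>) *\<^sub>R \<eta> - (g - blinfun_apply A w)"
  have "blinfun_apply A v = \<alpha> *\<^sub>R (k - e)"
    using e \<alpha> by (auto simp: v_def k_def blinfun.add_right blinfun.scaleR_right algebra_simps)
  then have "0 \<le> (k - e) \<bullet> v" using acc[of v] \<alpha> by (simp add: zero_le_mult_iff)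
  moreover have "k \<bullet> v \<le> t * ((1 + c) * E + s)"
  proof -
    have "norm k \<le> t"
      using norm_triangle_ineq4[of "(1 / \<alpha>) *\<^sub>R \<eta>" "g - blinfun_apply A w"] \<alpha>
      by (simp add: k_def t_def)
    moreover have "norm v \<le> (1 + c) * E + s"
      using norm_triangle_ineq[of "blinfun_apply M e" "\<alpha> *\<^sub>R w"] \<alpha> inner_near_identity(2)[OF M, of e]
      by (simp add: v_def s_def E_def)
    ultimately have "norm k * norm v \<le> t * ((1 + c) * E + s)"
      using pos by (intro mult_mono) auto
    then show ?thesis using norm_cauchy_schwarz[of k v] by linarith
  qed
  moreover have "(1 - c) * E\<^sup>2 - s * E \<le> e \<bullet> v"
  proof -
    have "- (e \<bullet> (\<alpha> *\<^sub>R w)) \<le> E * s"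
      using Cauchy_Schwarz_ineq2[of e "\<alpha> *\<^sub>R w"] \<alpha> by (simp add: E_def s_def)
    then show ?thesis using inner_near_identity(1)[OF M, of e]
      by (simp add: v_def inner_add_right E_def mult.commute)
  qed
  ultimately have main: "(1 - c) * E\<^sup>2 \<le> s * E + t * ((1 + c) * E + s)"
    by (simp add: inner_diff_left)
  have "E \<le> 4 / (1 - c) * u"
  proof (cases "E \<le> u")
    case True
    moreover have "1 * u \<le> 4 / (1 - c) * u"
      using c c0 pos by (intro mult_right_mono) (auto simp: u_def field_simps)
    ultimately show ?thesis by simp
  next
    case False
    have "s * E \<le> u * E" using pos by (intro mult_right_mono) (auto simp: u_def)
    moreover have "t * ((1 + c) * E + s) \<le> u * (2 * E + E)"
      using pos c c0 False by (intro mult_mono add_mono mult_right_mono) (auto simp: u_def)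
    ultimately have "(1 - c) * E\<^sup>2 \<le> u * E + u * (2 * E + E)" using main by linarith
    then have "((1 - c) * E) * E \<le> (4 * u) * E"
      by (simp add: power2_eq_square algebra_simps)
    moreover have "E > 0" using False pos by (auto simp: u_def)
    ultimately have "(1 - c) * E \<le> 4 * u" by simp
    then show ?thesis using c by (simp add: field_simps)
  qed
  then show ?thesis by (simp add: E_def u_def s_def t_def add.assoc)
qed

section \<open>Convergence of Lavrentiev regularization\<close>

text \<open>Put \<open>u n = x n - xbar\<close>.
  Monotonicity between two regularized solutions gives
  \<open>\<parallel>u n - u m\<parallel>\<^sup>2 \<le> \<bar>\<parallel>u n\<parallel>\<^sup>2 - \<parallel>u m\<parallel>\<^sup>2\<bar>\<close> up to a term that vanishes with \<open>d/a\<close>. As the real sequence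
  \<open>\<parallel>u n\<parallel>\<^sup>2\<close> is bounded, it converges along a subsequence, and along the same subsequence \<open>u\<close> is
  Cauchy. Minty's device identifies the limit as a solution, and the inequality against \<open>xdag\<close>
  forces it to be the one of minimal distance.\<close>

lemma lavrentiev_subsequence_tendsto:
  fixes F :: "'a::{real_inner,complete_space} \<Rightarrow> 'a" and a d :: "nat \<Rightarrow> real"
  assumes hemi: "hemicontinuous F" and mono: "monotone_operator F"
    and min: "min_norm_solution F y xbar xdag"
    and a: "\<And>n. a n > 0" "a \<longlonglongrightarrow> 0"
    and yd: "\<And>n. norm (y - yd n) \<le> d n" and da: "(\<lambda>n. d n / a n) \<longlonglongrightarrow> 0"
    and x: "\<And>n. lavrentiev_solution F xbar (a n) (yd n) (x n)"
  shows "\<exists>r::nat \<Rightarrow> nat. strict_mono r \<and> (x \<circ> r) \<longlonglongrightarrow> xdag"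
proof -
  define \<epsilon> where "\<epsilon> = (\<lambda>n. d n / a n)"
  have d: "d n = \<epsilon> n * a n" for n using a(1)[of n] by (simp add: \<epsilon>_def)
  have \<epsilon>: "\<epsilon> \<longlonglongrightarrow> 0" using da by (simp add: \<epsilon>_def)
  have \<epsilon>0: "0 \<le> \<epsilon> n" for n
    using order_trans[OF norm_ge_zero yd[of n]] a(1)[of n] by (simp add: \<epsilon>_def)
  define u where "u = (\<lambda>n. x n - xbar)"
  define b where "b = (\<lambda>n. (norm (u n))\<^sup>2)"
  have Fx: "F (x n) = yd n - a n *\<^sub>R u n" for n
    using x[of n] by (simp add: lavrentiev_solution_def u_def algebra_simps)
  have Fdag: "F xdag = y" using min by (simp add: min_norm_solution_def)
  have test: "u n \<bullet> (x n - xdag) \<le> \<epsilon> n * norm (x n - xdag)" for n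
  proof -
    have "0 \<le> (F (x n) - F xdag) \<bullet> (x n - xdag)"
      using mono by (simp add: monotone_operator_def)
    then have "a n * (u n \<bullet> (x n - xdag)) \<le> (yd n - y) \<bullet> (x n - xdag)"
      by (simp add: Fx Fdag inner_diff_left)
    also have "\<dots> \<le> norm (yd n - y) * norm (x n - xdag)" by (rule norm_cauchy_schwarz)
    also have "\<dots> \<le> d n * norm (x n - xdag)"
      using yd[of n] by (intro mult_right_mono) (auto simp: norm_minus_commute)
    finally have "a n * (u n \<bullet> (x n - xdag)) \<le> a n * (\<epsilon> n * norm (x n - xdag))"
      by (simp add: d mult_ac)
    then show ?thesis using a(1)[of n] by simp
  qed
  obtain K0 where K0: "\<And>n. norm (\<epsilon> n) \<le> K0"
    using \<epsilon> by (meson BseqE convergentI convergent_imp_Bseq)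
  define K where "K = 2 * norm (xdag - xbar) + K0"
  have uK: "norm (u n) \<le> K" for n
  proof -
    let ?e = "x n - xdag"
    have "u n \<bullet> ?e = ?e \<bullet> ?e + (xdag - xbar) \<bullet> ?e"
      by (simp add: u_def inner_diff_left)
    moreover have "- ((xdag - xbar) \<bullet> ?e) \<le> norm (xdag - xbar) * norm ?e"
      using Cauchy_Schwarz_ineq2[of "xdag - xbar" ?e] by linarith
    ultimately have "norm ?e * norm ?e \<le> (\<epsilon> n + norm (xdag - xbar)) * norm ?e"
      using test[of n] by (simp add: distrib_right flip: power2_norm_eq_inner power2_eq_square)
    then have "norm ?e \<le> \<epsilon> n + norm (xdag - xbar)"
      using \<epsilon>0[of n] by (cases "?e = 0") auto
    moreover have "norm (u n) \<le> norm ?e + norm (xdag - xbar)"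
      using norm_triangle_ineq[of ?e "xdag - xbar"] by (simp add: u_def)
    ultimately show ?thesis using K0[of n] by (simp add: K_def)
  qed
  then have K: "0 \<le> K" using norm_ge_zero order_trans by blast
  have pair: "(norm (u n - u m))\<^sup>2 \<le> \<bar>b n - b m\<bar> + 4 * K * (\<epsilon> n + \<epsilon> m)" for n m
  proof -
    let ?D = "u n - u m"
    have "x n - x m = ?D" by (simp add: u_def)
    then have "0 \<le> (F (x n) - F (x m)) \<bullet> ?D"
      using mono unfolding monotone_operator_def by metis
    then have 1: "(a n *\<^sub>R u n - a m *\<^sub>R u m) \<bullet> ?D \<le> (yd n - yd m) \<bullet> ?D"
      by (simp add: Fx inner_diff_left)
    \<comment> \<open>Polarization; the mixed term carries the difference of the squared norms.\<close>
    have 2: "2 * ((a n *\<^sub>R u n - a m *\<^sub>R u m) \<bullet> ?D)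
        = (a n + a m) * (norm ?D)\<^sup>2 + (a n - a m) * (b n - b m)"
      unfolding b_def power2_norm_eq_inner
      by (simp add: inner_diff_left inner_diff_right inner_commute algebra_simps)
    have 3: "(yd n - yd m) \<bullet> ?D \<le> ((a n + a m) * (\<epsilon> n + \<epsilon> m)) * (2 * K)"
    proof -
      have "norm (yd n - yd m) \<le> d n + d m"
        using yd[of n] yd[of m] norm_triangle_ineq4[of "y - yd m" "y - yd n"] by simp
      also have "\<dots> \<le> (a n + a m) * (\<epsilon> n + \<epsilon> m)"
        using a(1)[of n] a(1)[of m] \<epsilon>0[of n] \<epsilon>0[of m] by (simp add: d algebra_simps)
      finally have "norm (yd n - yd m) \<le> (a n + a m) * (\<epsilon> n + \<epsilon> m)" .
      moreover have "norm ?D \<le> 2 * K"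
        using uK[of n] uK[of m] norm_triangle_ineq4[of "u n" "u m"] by linarith
      ultimately have "norm (yd n - yd m) * norm ?D \<le> ((a n + a m) * (\<epsilon> n + \<epsilon> m)) * (2 * K)"
        using a(1)[of n] a(1)[of m] \<epsilon>0[of n] \<epsilon>0[of m] by (intro mult_mono) auto
      then show ?thesis using norm_cauchy_schwarz order_trans by blast
    qed
    have "- ((a n - a m) * (b n - b m)) \<le> \<bar>a n - a m\<bar> * \<bar>b n - b m\<bar>"
      by (metis abs_ge_minus_self abs_mult)
    also have "\<dots> \<le> (a n + a m) * \<bar>b n - b m\<bar>"
      using a(1)[of n] a(1)[of m] by (intro mult_right_mono) auto
    finally have "(a n + a m) * (norm ?D)\<^sup>2
        \<le> (a n + a m) * (\<bar>b n - b m\<bar> + 4 * K * (\<epsilon> n + \<epsilon> m))"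
      using 1 2 3 by (simp add: algebra_simps)
    then show ?thesis using a(1)[of n] a(1)[of m] by simp
  qed
  have "bounded (range b)"
    unfolding bounded_iff using uK by (auto simp: b_def intro!: exI[of _ "K\<^sup>2"] power_mono)
  then obtain l and r :: "nat \<Rightarrow> nat" where r: "strict_mono r" and l: "(b \<circ> r) \<longlonglongrightarrow> l"
    using bounded_imp_convergent_subsequence by blast
  have lim_r: "(f \<circ> r) \<longlonglongrightarrow> c" if "f \<longlonglongrightarrow> c" for f and c :: real
    using LIMSEQ_subseq_LIMSEQ[OF that r] .
  have "Cauchy (\<lambda>n. u (r n))"
  proof (rule metric_CauchyI)
    fix \<eta> :: real assume \<eta>: "\<eta> > 0"
    \<comment> \<open>Makes the error terms in \<open>pair\<close> add up to \<open>\<eta>\<^sup>2\<close>.\<close>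
    define \<kappa> where "\<kappa> = \<eta>\<^sup>2 / (8 * K + 1)"
    have \<kappa>: "\<kappa> > 0" using \<eta> K by (simp add: \<kappa>_def)
    have "Cauchy (b \<circ> r)" using l by (rule LIMSEQ_imp_Cauchy)
    then obtain N1 where N1: "\<And>m n. m \<ge> N1 \<Longrightarrow> n \<ge> N1 \<Longrightarrow> \<bar>b (r m) - b (r n)\<bar> < \<kappa>"
      using metric_CauchyD[OF _ \<kappa>] by (fastforce simp: dist_real_def)
    obtain N2 where N2: "\<And>n. n \<ge> N2 \<Longrightarrow> \<epsilon> (r n) < \<kappa>"
      using order_tendstoD(2)[OF lim_r[OF \<epsilon>] \<kappa>] by (auto simp: eventually_sequentially)
    show "\<exists>M. \<forall>m\<ge>M. \<forall>n\<ge>M. dist (u (r m)) (u (r n)) < \<eta>"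
    proof (intro exI[of _ "max N1 N2"] allI impI)
      fix m n assume mn: "max N1 N2 \<le> m" "max N1 N2 \<le> n"
      have "(norm (u (r m) - u (r n)))\<^sup>2
          \<le> \<bar>b (r m) - b (r n)\<bar> + 4 * K * (\<epsilon> (r m) + \<epsilon> (r n))" by (rule pair)
      also have "\<dots> < \<kappa> + 4 * K * (\<kappa> + \<kappa>)"
        using mn N1[of m n] N2[of m] N2[of n] K
        by (intro add_less_le_mono mult_left_mono add_mono) auto
      also have "\<dots> = \<kappa> * (8 * K + 1)" by (simp add: algebra_simps)
      also have "\<dots> = \<eta>\<^sup>2" using K by (simp add: \<kappa>_def)
      finally show "dist (u (r m)) (u (r n)) < \<eta>"
        using \<eta> by (metis dist_norm less_imp_le power_less_imp_less_base)
    qed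
  qed
  then obtain u0 where u0: "(\<lambda>n. u (r n)) \<longlonglongrightarrow> u0"
    using Cauchy_convergent_iff convergent_def by blast
  define x0 where "x0 = u0 + xbar"
  have x0: "(\<lambda>n. x (r n)) \<longlonglongrightarrow> x0"
    using tendsto_add[OF u0 tendsto_const[of xbar]] by (simp add: u_def x0_def)
  have "(\<lambda>n. d (r n)) \<longlonglongrightarrow> 0"
    using tendsto_mult[OF lim_r[OF \<epsilon>] lim_r[OF a(2)]] by (simp add: d o_def)
  then have "(\<lambda>n. y - yd (r n)) \<longlonglongrightarrow> 0"
    by (rule Lim_null_comparison[rotated]) (simp add: yd)
  from tendsto_diff[OF tendsto_const[of y] this]
  have yd_lim: "(\<lambda>n. yd (r n)) \<longlonglongrightarrow> y" by simp
  have F_lim: "(\<lambda>n. F (x (r n))) \<longlonglongrightarrow> y"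
    using tendsto_diff[OF yd_lim tendsto_scaleR[OF lim_r[OF a(2)] u0]]
    by (simp add: Fx o_def)
  \<comment> \<open>\<open>F\<close> may be discontinuous at \<open>x0\<close>, so monotonicity is tested at a fixed \<open>z\<close> instead;
    hemicontinuity then lets \<open>z\<close> approach \<open>x0\<close> along rays.\<close>
  have minty: "0 \<le> (F z - y) \<bullet> (z - x0)" for z
  proof (rule tendsto_lowerbound[OF _ always_eventually])
    show "(\<lambda>n. (F z - F (x (r n))) \<bullet> (z - x (r n))) \<longlonglongrightarrow> (F z - y) \<bullet> (z - x0)"
      by (intro tendsto_intros F_lim x0)
  qed (use mono in \<open>auto simp: monotone_operator_def\<close>)
  have half: "0 \<le> (F x0 - y) \<bullet> h" for h
  proof (rule tendsto_lowerbound)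
    have "continuous_on UNIV (\<lambda>t::real. F (x0 + t *\<^sub>R h) \<bullet> h)"
      using hemi by (simp add: hemicontinuous_def)
    then have "((\<lambda>t::real. F (x0 + t *\<^sub>R h) \<bullet> h) \<longlongrightarrow> F (x0 + 0 *\<^sub>R h) \<bullet> h) (at 0)"
      by (metis UNIV_I continuous_on_def)
    then have "((\<lambda>t::real. F (x0 + t *\<^sub>R h) \<bullet> h) \<longlongrightarrow> F x0 \<bullet> h) (at_right 0)"
      using filterlim_at_split by force
    from tendsto_diff[OF this tendsto_const[of "y \<bullet> h"]]
    show "((\<lambda>t::real. (F (x0 + t *\<^sub>R h) - y) \<bullet> h) \<longlongrightarrow> (F x0 - y) \<bullet> h) (at_right 0)"
      by (simp add: inner_diff_left)
    have "0 \<le> (F (x0 + t *\<^sub>R h) - y) \<bullet> h" if "t > 0" for t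
      using minty[of "x0 + t *\<^sub>R h"] that by (simp add: zero_le_mult_iff)
    then show "\<forall>\<^sub>F t in at_right 0. 0 \<le> (F (x0 + t *\<^sub>R h) - y) \<bullet> h"
      by (auto simp: eventually_at_filter)
  qed simp
  have "F x0 = y"
  proof -
    have "0 \<le> - ((F x0 - y) \<bullet> (F x0 - y))"
      using half[of "- (F x0 - y)"] by (simp only: inner_minus_right)
    then have "(F x0 - y) \<bullet> (F x0 - y) = 0" by (metis inner_ge_zero neg_0_le_iff_le order_antisym)
    then show ?thesis by simp
  qed
  then have "norm (xdag - xbar) \<le> norm (x0 - xbar)"
    using min by (simp add: min_norm_solution_def)
  then have sq: "(norm (xdag - xbar))\<^sup>2 \<le> (norm (x0 - xbar))\<^sup>2" by (simp add: power_mono)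
  \<comment> \<open>The angle at \<open>x0\<close> between \<open>xbar\<close> and \<open>xdag\<close> is not acute, so \<open>xdag\<close> is farther from \<open>xbar\<close>
    than \<open>x0\<close> unless the two coincide; \<open>sq\<close> says that it is not farther.\<close>
  have "(x0 - xbar) \<bullet> (x0 - xdag) \<le> 0 * norm (x0 - xdag)"
  proof (rule tendsto_le)
    show "(\<lambda>n. \<epsilon> (r n) * norm (x (r n) - xdag)) \<longlonglongrightarrow> 0 * norm (x0 - xdag)"
      using lim_r[OF \<epsilon>] by (intro tendsto_intros x0) (simp add: o_def)
    show "(\<lambda>n. u (r n) \<bullet> (x (r n) - xdag)) \<longlonglongrightarrow> (x0 - xbar) \<bullet> (x0 - xdag)"
      using u0 by (intro tendsto_intros x0) (simp add: x0_def)
  qed (auto intro!: always_eventually test)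
  moreover have "(norm (x0 - xdag))\<^sup>2 = (norm (xdag - xbar))\<^sup>2 - (norm (x0 - xbar))\<^sup>2
      + 2 * ((x0 - xbar) \<bullet> (x0 - xdag))"
    unfolding power2_norm_eq_inner
    by (simp add: inner_diff_left inner_diff_right inner_commute algebra_simps)
  ultimately have "(norm (x0 - xdag))\<^sup>2 \<le> 0" using sq unfolding mult_zero_left by linarith
  then have "x0 = xdag" by simp
  then show ?thesis using r x0 by (auto simp: o_def)
qed

text \<open>The previous lemma applies to every subsequence, in particular to one that stays away from
  \<open>xdag\<close>.\<close>

lemma lavrentiev_sequence_tendsto:
  fixes F :: "'a::{real_inner,complete_space} \<Rightarrow> 'a" and a d :: "nat \<Rightarrow> real"
  assumes "hemicontinuous F" and "monotone_operator F"
    and "min_norm_solution F y xbar xdag"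
    and "\<And>n. a n > 0" "a \<longlonglongrightarrow> 0"
    and "\<And>n. norm (y - yd n) \<le> d n" and "(\<lambda>n. d n / a n) \<longlonglongrightarrow> 0"
    and "\<And>n. lavrentiev_solution F xbar (a n) (yd n) (x n)"
  shows "x \<longlonglongrightarrow> xdag"
proof (rule ccontr)
  assume "\<not> x \<longlonglongrightarrow> xdag"
  then obtain e where e: "e > 0" and inf: "infinite {n. e \<le> dist (x n) xdag}"
    unfolding LIMSEQ_def INFM_nat_le[unfolded INFM_iff_infinite] infinite_nat_iff_unbounded_le
    by (auto simp: not_less)
  define r where "r = enumerate {n. e \<le> dist (x n) xdag}"
  have r: "strict_mono r" unfolding r_def by (rule strict_mono_enumerate[OF inf])
  have far: "e \<le> dist (x (r n)) xdag" for n
    using enumerate_in_set[OF inf, of n] by (simp add: r_def)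
  have "\<exists>r'::nat \<Rightarrow> nat. strict_mono r' \<and> ((x \<circ> r) \<circ> r') \<longlonglongrightarrow> xdag"
  proof (rule lavrentiev_subsequence_tendsto[OF assms(1-3)])
    show "(\<lambda>n. (a \<circ> r) n) \<longlonglongrightarrow> 0" using LIMSEQ_subseq_LIMSEQ[OF assms(5) r] by (simp add: o_def)
    show "(\<lambda>n. (d \<circ> r) n / (a \<circ> r) n) \<longlonglongrightarrow> 0"
      using LIMSEQ_subseq_LIMSEQ[OF assms(7) r] by (simp add: o_def)
    show "norm (y - (yd \<circ> r) n) \<le> (d \<circ> r) n" for n using assms(6) by simp
    show "lavrentiev_solution F xbar ((a \<circ> r) n) ((yd \<circ> r) n) ((x \<circ> r) n)" for n
      using assms(8) by simp
  qed (use assms(4) in simp)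
  then obtain r' :: "nat \<Rightarrow> nat" where "(\<lambda>n. x (r (r' n))) \<longlonglongrightarrow> xdag" by (auto simp: o_def)
  then obtain n where "dist (x (r (r' n))) xdag < e" using e unfolding LIMSEQ_def by blast
  then show False using far[of "r' n"] by simp
qed

lemma lavrentiev_tendsto:
  fixes F :: "'a::{real_inner,complete_space} \<Rightarrow> 'a" and \<alpha> :: "real \<Rightarrow> real"
  assumes F: "hemicontinuous F" "monotone_operator F" "min_norm_solution F y xbar xdag"
    and \<alpha>: "\<And>\<delta>. \<delta> > 0 \<Longrightarrow> \<alpha> \<delta> > 0" "(\<alpha> \<longlongrightarrow> 0) (at_right 0)"
      "((\<lambda>\<delta>. \<delta> / \<alpha> \<delta>) \<longlongrightarrow> 0) (at_right 0)"
    and yd: "\<And>\<delta>. \<delta> > 0 \<Longrightarrow> norm (y - yd \<delta>) \<le> \<delta>"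
    and x: "\<And>\<delta>. \<delta> > 0 \<Longrightarrow> lavrentiev_solution F xbar (\<alpha> \<delta>) (yd \<delta>) (x \<delta>)"
  shows "(x \<longlongrightarrow> xdag) (at_right 0)"
proof (rule tendsto_at_right_sequentially[of 0 1])
  fix S :: "nat \<Rightarrow> real" assume S: "\<And>n. 0 < S n" "S \<longlonglongrightarrow> 0"
  have "filterlim S (at_right 0) sequentially"
    using S by (auto simp: filterlim_at intro!: always_eventually less_imp_neq[symmetric])
  note lim = filterlim_compose[OF _ this]
  show "(\<lambda>n. x (S n)) \<longlonglongrightarrow> xdag"
    using lim[OF \<alpha>(2)] lim[OF \<alpha>(3)] \<alpha>(1) yd x S(1)
    by (intro lavrentiev_sequence_tendsto[OF F, of "\<lambda>n. \<alpha> (S n)" "\<lambda>n. yd (S n)" S]) auto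
qed simp

section \<open>The distance function\<close>

lemma dist_fun_le:
  assumes "norm w \<le> R"
  shows "dist_fun A g R \<le> norm (g - blinfun_apply A w)"
  unfolding dist_fun_def using assms
  by (intro cINF_lower bdd_belowI2[of _ 0]) auto

lemma dist_fun_greatest:
  assumes "R \<ge> 0" and "\<And>w. norm w \<le> R \<Longrightarrow> m \<le> norm (g - blinfun_apply A w)"
  shows "m \<le> dist_fun A g R"
  unfolding dist_fun_def using assms by (intro cINF_greatest) auto

lemma dist_fun_near:
  assumes "R \<ge> 0" and "dist_fun A g R < m"
  shows "\<exists>w. norm w \<le> R \<and> norm (g - blinfun_apply A w) < m"
  using dist_fun_greatest[OF assms(1), of m g A] assms(2) by (meson not_le)

lemma dist_fun_nonneg: "R \<ge> 0 \<Longrightarrow> 0 \<le> dist_fun A g R"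
  by (rule dist_fun_greatest) auto

lemma dist_fun_antimono:
  assumes "0 \<le> R" "R \<le> R'"
  shows "dist_fun A g R' \<le> dist_fun A g R"
  using assms by (intro dist_fun_greatest dist_fun_le) auto

text \<open>Shrinking a competitor for the radius \<open>R'\<close> by the factor \<open>R/R'\<close> moves it by at most
  \<open>R' - R\<close>.\<close>

lemma dist_fun_lipschitz: "(norm A)-lipschitz_on {0<..} (dist_fun A g)"
proof (rule lipschitz_on_leI)
  fix R R' :: real assume R: "R \<in> {0<..}" "R' \<in> {0<..}" "R \<le> R'"
  have "dist_fun A g R - norm A * (R' - R) \<le> dist_fun A g R'"
  proof (rule dist_fun_greatest)
    fix w :: 'a assume w: "norm w \<le> R'"
    define v where "v = (R / R') *\<^sub>R w"
    have "norm v \<le> R" using R w by (simp add: v_def field_simps)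
    moreover have "norm (w - v) \<le> R' - R"
    proof -
      have "w - v = (1 - R / R') *\<^sub>R w" by (simp add: v_def algebra_simps)
      also have "norm \<dots> = (1 - R / R') * norm w" using R by simp
      also have "\<dots> \<le> (1 - R / R') * R'" using R w by (intro mult_left_mono) auto
      finally show ?thesis using R by (simp add: field_simps)
    qed
    moreover have "norm (g - blinfun_apply A v)
        \<le> norm (g - blinfun_apply A w) + norm (blinfun_apply A (w - v))"
      using norm_triangle_ineq[of "g - blinfun_apply A w" "blinfun_apply A (w - v)"]
      by (simp add: blinfun.diff_right)
    moreover have "norm (blinfun_apply A (w - v)) \<le> norm A * norm (w - v)" by (rule norm_blinfun)
    ultimately show "dist_fun A g R - norm A * (R' - R) \<le> norm (g - blinfun_apply A w)"
      using dist_fun_le[of v R A g] mult_left_mono[of "norm (w - v)" "R' - R" "norm A"] by simp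
  qed (use R in simp)
  then show "dist (dist_fun A g R) (dist_fun A g R') \<le> norm A * dist R R'"
    using R dist_fun_antimono[of R R' A g] by (simp add: dist_real_def abs_if)
qed simp

text \<open>The image of a closed ball under \<open>A\<close> is closed, because balls are weakly compact. Concretely,
  the near-preimages of \<open>g\<close> form a decreasing sequence of convex sets \<open>C n\<close> whose minimal
  norms \<open>m n\<close> are bounded by \<open>R\<close>; the parallelogram law makes nearly minimal elements a Cauchy sequence,
  whose limit is a preimage. Hence \<open>d\<close> is positive if \<open>g\<close> is not in the range.\<close>

lemma range_closed_on_balls:
  fixes A :: "'a::{real_inner,complete_space} \<Rightarrow>\<^sub>L 'a"
  assumes near: "\<And>\<eta>. \<eta> > 0 \<Longrightarrow> \<exists>w. norm w \<le> R \<and> norm (g - blinfun_apply A w) \<le> \<eta>"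
  shows "g \<in> range (blinfun_apply A)"
proof -
  define e where "e = (\<lambda>n::nat. inverse (real (Suc n)))"
  define C where "C = (\<lambda>n. {w. norm (g - blinfun_apply A w) \<le> e n})"
  define m where "m = (\<lambda>n. INF w\<in>C n. norm w)"
  have e: "e n > 0" for n by (simp add: e_def)
  have e_lim: "e \<longlonglongrightarrow> 0" unfolding e_def by (rule LIMSEQ_inverse_real_of_nat)
  have ne: "\<exists>w\<in>C n. norm w \<le> R" for n using near[OF e[of n]] by (auto simp: C_def)
  have m_le: "m n \<le> norm w" if "w \<in> C n" for n w
    unfolding m_def using that by (intro cINF_lower bdd_belowI2[of _ 0]) auto
  have C_anti: "C k \<subseteq> C n" if "n \<le> k" for n k
  proof -
    have "e k \<le> e n" using that by (simp add: e_def)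
    then show ?thesis by (auto simp: C_def)
  qed
  have "\<exists>w\<in>C n. norm w < m n + e n" for n
  proof -
    have "C n \<noteq> {}" "bdd_below (norm ` C n)"
      using ne[of n] by (auto intro!: bdd_belowI2[of _ 0])
    then show ?thesis
      using e[of n] cINF_less_iff[of "C n" norm "m n + e n"] by (simp add: m_def)
  qed
  then obtain w where w: "\<And>n. w n \<in> C n" "\<And>n. norm (w n) < m n + e n" by metis
  have m0: "0 \<le> m n" for n
    unfolding m_def using ne[of n] by (intro cINF_greatest) auto
  have mR: "m n \<le> R" for n using ne[of n] m_le by (meson order_trans)
  have "incseq m"
    unfolding incseq_def
  proof (intro allI impI)
    fix n k :: nat assume "n \<le> k"
    then have "m n \<le> norm v" if "v \<in> C k" for v
      using C_anti that by (intro m_le) blast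
    then show "m n \<le> m k"
      unfolding m_def[THEN fun_cong, of k] using ne[of k] by (intro cINF_greatest) auto
  qed
  then obtain l where l: "m \<longlonglongrightarrow> l"
    using incseq_convergent[of m R] mR by blast
  have wl: "(\<lambda>n. norm (w n)) \<longlonglongrightarrow> l"
  proof (rule real_tendsto_sandwich[where f = m and h = "\<lambda>n. m n + e n"])
    show "(\<lambda>n. m n + e n) \<longlonglongrightarrow> l" using tendsto_add[OF l e_lim] by simp
    show "\<forall>\<^sub>F n in sequentially. m n \<le> norm (w n)" using w(1) m_le by simp
    show "\<forall>\<^sub>F n in sequentially. norm (w n) \<le> m n + e n" using w(2) by (simp add: less_imp_le)
  qed (rule l)
  have par: "(norm (w k - w n))\<^sup>2 \<le> 2 * (norm (w n))\<^sup>2 + 2 * (norm (w k))\<^sup>2 - 4 * (m n)\<^sup>2"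
    if "n \<le> k" for n k
  proof -
    define v where "v = (1 / 2) *\<^sub>R (w n + w k)"
    have "g - blinfun_apply A v
        = (1 / 2) *\<^sub>R ((g - blinfun_apply A (w n)) + (g - blinfun_apply A (w k)))"
    proof -
      have "(g - p) + (g - q) = (g + g) - (p + q)" for p q :: 'a by simp
      then show ?thesis
        by (simp only: v_def blinfun.add_right blinfun.scaleR_right scaleR_diff_right
            scaleR_half_double)
    qed
    moreover have "norm (g - blinfun_apply A (w n)) \<le> e n" "norm (g - blinfun_apply A (w k)) \<le> e n"
      using w(1)[of n] w(1)[of k] C_anti[OF that] by (auto simp: C_def)
    ultimately have "norm (g - blinfun_apply A v) \<le> e n"
      using norm_triangle_ineq[of "g - blinfun_apply A (w n)" "g - blinfun_apply A (w k)"] by simp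
    then have "m n \<le> norm v" by (intro m_le) (simp add: C_def)
    then have "(m n)\<^sup>2 \<le> (norm v)\<^sup>2" using m0 by (simp add: power_mono)
    moreover have "4 * (norm v)\<^sup>2 = (norm (w n + w k))\<^sup>2"
      by (simp add: v_def power_divide)
    moreover have "(norm (w n + w k))\<^sup>2 + (norm (w k - w n))\<^sup>2
        = 2 * (norm (w n))\<^sup>2 + 2 * (norm (w k))\<^sup>2"
      unfolding power2_norm_eq_inner
      by (simp add: inner_add_left inner_add_right inner_diff_left inner_diff_right inner_commute)
    ultimately show ?thesis by linarith
  qed
  have "Cauchy w"
    unfolding Cauchy_altdef2
  proof (intro allI impI)
    fix \<eta> :: real assume \<eta>: "\<eta> > 0"
    have "(\<lambda>n. (norm (w n))\<^sup>2) \<longlonglongrightarrow> l\<^sup>2" "(\<lambda>n. (m n)\<^sup>2) \<longlonglongrightarrow> l\<^sup>2"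
      using wl l by (auto intro: tendsto_power)
    from this[THEN tendstoD, of "\<eta>\<^sup>2 / 8"] have "\<forall>\<^sub>F n in sequentially. \<bar>(norm (w n))\<^sup>2 - l\<^sup>2\<bar> < \<eta>\<^sup>2 / 8 \<and> \<bar>(m n)\<^sup>2 - l\<^sup>2\<bar> < \<eta>\<^sup>2 / 8"
      using \<eta> by (simp add: dist_real_def eventually_conj)
    then obtain N where N: "\<And>n. n \<ge> N \<Longrightarrow>
        \<bar>(norm (w n))\<^sup>2 - l\<^sup>2\<bar> < \<eta>\<^sup>2 / 8 \<and> \<bar>(m n)\<^sup>2 - l\<^sup>2\<bar> < \<eta>\<^sup>2 / 8"
      unfolding eventually_sequentially by blast
    have "dist (w n) (w N) < \<eta>" if "n \<ge> N" for n
    proof -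
      have "(norm (w n - w N))\<^sup>2 < \<eta>\<^sup>2"
        using par[OF that] N[OF that] N[OF order_refl] unfolding abs_less_iff by linarith
      then show ?thesis using \<eta> by (metis dist_norm less_imp_le power_less_imp_less_base)
    qed
    then show "\<exists>N. \<forall>n\<ge>N. dist (w n) (w N) < \<eta>" by blast
  qed
  then obtain w0 where "w \<longlonglongrightarrow> w0" using Cauchy_convergent_iff convergent_def by blast
  then have "(\<lambda>n. g - blinfun_apply A (w n)) \<longlonglongrightarrow> g - blinfun_apply A w0"
    by (intro tendsto_intros)
  moreover have "(\<lambda>n. g - blinfun_apply A (w n)) \<longlonglongrightarrow> 0"
    using w(1) by (intro Lim_null_comparison[OF always_eventually e_lim]) (auto simp: C_def)
  ultimately have "g - blinfun_apply A w0 = 0" using LIMSEQ_unique by blast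
  then show ?thesis by auto
qed

text \<open>Both \<open>d R / R\<close> and \<open>(d R)\<^sup>2 / R\<close> satisfy such bounds because \<open>d\<close> is decreasing; this makes
  \<open>chi\<close> and \<open>phi\<close> onto.\<close>

lemma hyperbola_bounds_surj:
  fixes f :: "real \<Rightarrow> real"
  assumes cont: "continuous_on {0<..} f" and m: "m > 0"
    and lower: "\<And>R. 0 < R \<Longrightarrow> R \<le> 1 \<Longrightarrow> m / R \<le> f R"
    and upper: "\<And>R. 1 \<le> R \<Longrightarrow> f R \<le> K / R"
    and b: "b > 0"
  shows "\<exists>R>0. f R = b"
proof -
  define r where "r = min 1 (m / b)"
  define s where "s = max 1 (K / b)"
  have r: "0 < r" "r \<le> 1" "r \<le> m / b" using b m by (auto simp: r_def)
  have s: "1 \<le> s" "K / b \<le> s" by (auto simp: s_def)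
  have "b \<le> m / r" using r b by (simp add: pos_le_divide_eq mult.commute)
  then have 1: "b \<le> f r" using lower[OF r(1,2)] by linarith
  have "K / s \<le> b" using s b by (simp add: pos_divide_le_eq mult.commute)
  then have 2: "f s \<le> b" using upper[OF s(1)] by linarith
  have rs: "f r \<in> f ` {0<..}" "f s \<in> f ` {0<..}" using r s by auto
  have "connected (f ` {0<..})"
    by (intro connected_continuous_image cont convex_connected) (rule convex_real_interval)
  from connectedD_interval[OF this rs(2,1) 2 1] have "b \<in> f ` {0<..}" .
  then obtain R where "R \<in> {0<..}" "b = f R" by (rule imageE)
  then show ?thesis by (intro exI[of _ R]) simp
qed

locale unattained_source =
  fixes A :: "'a::{real_inner,complete_space} \<Rightarrow>\<^sub>L 'a" and g :: 'a
  assumes dense_range: "closure (range (blinfun_apply A)) = UNIV"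
    and not_in_range: "g \<notin> range (blinfun_apply A)"
begin

abbreviation d :: "real \<Rightarrow> real" where "d \<equiv> dist_fun A g"

lemma d_pos: "R \<ge> 0 \<Longrightarrow> 0 < d R"
proof (rule ccontr)
  assume R: "R \<ge> 0" and "\<not> 0 < d R"
  then have "d R < \<eta>" if "\<eta> > 0" for \<eta> using that by linarith
  then have "\<exists>w. norm w \<le> R \<and> norm (g - blinfun_apply A w) \<le> \<eta>" if "\<eta> > 0" for \<eta>
    using dist_fun_near[OF R, of A g \<eta>] that by (meson less_imp_le)
  then show False using range_closed_on_balls not_in_range by blast
qed

lemma approximate_source: "\<eta> > 0 \<Longrightarrow> \<exists>w. norm (g - blinfun_apply A w) < \<eta>"
  using dense_range closure_approachable[of g "range (blinfun_apply A)"]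
  by (auto simp: dist_norm norm_minus_commute)

lemma d_arbitrarily_small: "\<eta> > 0 \<Longrightarrow> \<exists>R>0. d R < \<eta>"
proof -
  assume "\<eta> > 0"
  then obtain w where w: "norm (g - blinfun_apply A w) < \<eta>" using approximate_source by blast
  then have "d (norm w + 1) < \<eta>" using dist_fun_le[of w "norm w + 1" A g] by simp
  then show ?thesis by (intro exI[of _ "norm w + 1"]) (auto simp: add_nonneg_pos)
qed

text \<open>Density of the range provides \<open>w0\<close> with a residual below \<open>d R\<close>. Moving a competitor for the
  radius \<open>R\<close> slightly towards \<open>w0\<close> keeps it within radius \<open>R'\<close> and, by convexity, improves the
  infimum.\<close>

lemma d_strict_antimono:
  assumes R: "0 < R" "R < R'"
  shows "d R' < d R"
proof -
  obtain w0 where w0: "norm (g - blinfun_apply A w0) < d R"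
    using approximate_source d_pos R by (meson less_imp_le)
  \<comment> \<open>Small enough that the convex combination keeps its norm below \<open>R'\<close>.\<close>
  define t where "t = min 1 ((R' - R) / (norm w0 + 1))"
  have n0: "norm w0 + 1 > 0" by (simp add: add_nonneg_pos)
  have t: "0 < t" "t \<le> 1" using R n0 by (auto simp: t_def)
  have "t * norm w0 \<le> t * (norm w0 + 1)" using t by simp
  also have "\<dots> \<le> R' - R"
  proof -
    have "t \<le> (R' - R) / (norm w0 + 1)" by (simp add: t_def)
    then show ?thesis by (simp only: pos_le_divide_eq[OF n0])
  qed
  finally have tw: "t * norm w0 \<le> R' - R" .
  have key: "d R' \<le> (1 - t) * norm (g - blinfun_apply A w) + t * norm (g - blinfun_apply A w0)"
    if w: "norm w \<le> R" for w
  proof -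
    define v where "v = (1 - t) *\<^sub>R w + t *\<^sub>R w0"
    have "norm v \<le> (1 - t) * norm w + t * norm w0"
      using norm_triangle_ineq[of "(1 - t) *\<^sub>R w" "t *\<^sub>R w0"] t by (simp add: v_def)
    also have "(1 - t) * norm w \<le> 1 * R" using t w by (intro mult_mono) auto
    finally have "norm v \<le> R'" using tw by linarith
    then have "d R' \<le> norm (g - blinfun_apply A v)" by (rule dist_fun_le)
    also have "g - blinfun_apply A v
        = (1 - t) *\<^sub>R (g - blinfun_apply A w) + t *\<^sub>R (g - blinfun_apply A w0)"
    proof -
      have "blinfun_apply A v = (1 - t) *\<^sub>R blinfun_apply A w + t *\<^sub>R blinfun_apply A w0"
        by (simp add: v_def blinfun.add_right blinfun.scaleR_right)
      then show ?thesis by (simp only:) (simp add: algebra_simps)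
    qed
    also have "norm \<dots> \<le> (1 - t) * norm (g - blinfun_apply A w) + t * norm (g - blinfun_apply A w0)"
      using norm_triangle_ineq[of "(1 - t) *\<^sub>R (g - blinfun_apply A w)"
          "t *\<^sub>R (g - blinfun_apply A w0)"] t by simp
    finally show ?thesis .
  qed
  have "d R' \<le> (1 - t) * d R + t * norm (g - blinfun_apply A w0)"
  proof (rule field_le_epsilon)
    fix \<eta> :: real assume \<eta>: "\<eta> > 0"
    obtain w where w: "norm w \<le> R" "norm (g - blinfun_apply A w) < d R + \<eta>"
      using dist_fun_near[of R A g "d R + \<eta>"] R \<eta> by auto
    have "(1 - t) * norm (g - blinfun_apply A w) \<le> (1 - t) * (d R + \<eta>)"
      using w t by (intro mult_left_mono) auto
    also have "\<dots> \<le> (1 - t) * d R + \<eta>" using t \<eta> by (simp add: algebra_simps)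
    finally show "d R' \<le> (1 - t) * d R + t * norm (g - blinfun_apply A w0) + \<eta>"
      using key[OF w(1)] by linarith
  qed
  also have "\<dots> < (1 - t) * d R + t * d R" using w0 t by simp
  finally show ?thesis by (simp add: algebra_simps)
qed

lemma chi_strict_antimono:
  assumes "0 < R" "R < R'"
  shows "chi A g R' < chi A g R"
proof -
  have "d R' / R' < d R / R'"
    using assms d_strict_antimono[OF assms] by (intro divide_strict_right_mono) auto
  also have "\<dots> \<le> d R / R"
    using assms by (intro divide_left_mono dist_fun_nonneg) auto
  finally show ?thesis by (simp only: chi_def)
qed

lemma chi_pos: "R > 0 \<Longrightarrow> 0 < chi A g R"
  unfolding chi_def by (intro divide_pos_pos d_pos) auto

lemma d_continuous: "continuous_on {0<..} d"
  using dist_fun_lipschitz by (rule lipschitz_on_continuous_on)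

lemma chi_bij: "bij_betw (chi A g) {0<..} {0<..}"
proof (rule bij_betw_imageI)
  show "inj_on (chi A g) {0<..}"
  proof (rule linorder_inj_onI')
    fix a b :: real assume "a \<in> {0<..}" "a < b"
    then show "chi A g a \<noteq> chi A g b" using chi_strict_antimono[of a b] by simp
  qed
  have "\<exists>R>0. chi A g R = b" if "b > 0" for b
  proof (rule hyperbola_bounds_surj[OF _ d_pos[of 1] _ _ that, of "chi A g" "d 1"])
    show "continuous_on {0<..} (chi A g)"
      unfolding chi_def by (intro continuous_intros d_continuous) auto
    show "d 1 / R \<le> chi A g R" if "0 < R" "R \<le> 1" for R
      using dist_fun_antimono[of R 1 A g] that by (simp add: chi_def divide_right_mono)
    show "chi A g R \<le> d 1 / R" if "1 \<le> R" for R
      using dist_fun_antimono[of 1 R A g] that by (simp add: chi_def divide_right_mono)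
  qed simp
  then have "{0<..} \<subseteq> chi A g ` {0<..}" by (auto simp: image_iff Bex_def)
  moreover have "chi A g ` {0<..} \<subseteq> {0<..}" using chi_pos by auto
  ultimately show "chi A g ` {0<..} = {0<..}" by (rule equalityI[rotated])
qed

lemma chi_inv_chi: "R > 0 \<Longrightarrow> chi_inv A g (chi A g R) = R"
  unfolding chi_inv_def
  by (rule the_inv_into_f_f[OF bij_betw_imp_inj_on[OF chi_bij]]) simp

lemma chi_inv:
  assumes "a > 0"
  shows "chi_inv A g a > 0" and "chi A g (chi_inv A g a) = a"
proof -
  obtain R where R: "R > 0" "chi A g R = a"
  proof -
    have "a \<in> chi A g ` {0<..}" using bij_betw_imp_surj_on[OF chi_bij] assms by simp
    then show ?thesis using that by auto
  qed
  then show "chi_inv A g a > 0" "chi A g (chi_inv A g a) = a"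
    using chi_inv_chi[OF R(1)] by (simp_all add: R)
qed

text \<open>The choice \<open>R = chi_inv a\<close> equates the two contributions \<open>a R\<close> and \<open>d R\<close> to the error.\<close>

lemma chi_inv_balance: "a > 0 \<Longrightarrow> a * chi_inv A g a = d (chi_inv A g a)"
proof -
  assume a: "a > 0"
  have "chi A g (chi_inv A g a) * chi_inv A g a = d (chi_inv A g a)"
    using chi_inv(1)[OF a] by (simp add: chi_def)
  then show ?thesis by (simp only: chi_inv(2)[OF a])
qed

lemma chi_inv_strict_antimono:
  assumes "0 < a" "a < b"
  shows "chi_inv A g b < chi_inv A g a"
proof (rule ccontr)
  assume "\<not> ?thesis"
  then consider "chi_inv A g a = chi_inv A g b" | "chi_inv A g a < chi_inv A g b" by linarith
  then have "chi A g (chi_inv A g b) \<le> chi A g (chi_inv A g a)"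
  proof cases
    case 2
    then show ?thesis
      using chi_strict_antimono[OF chi_inv(1)[OF assms(1)]] by (simp add: less_imp_le)
  qed simp
  moreover have "chi A g (chi_inv A g a) = a" "chi A g (chi_inv A g b) = b"
    using assms by (auto intro: chi_inv(2))
  ultimately show False using assms by simp
qed

lemma rate_strict_mono:
  assumes "0 < a" "a < b"
  shows "d (chi_inv A g a) < d (chi_inv A g b)"
  by (intro d_strict_antimono chi_inv(1) chi_inv_strict_antimono) (use assms in auto)

lemma rate_pos: "a > 0 \<Longrightarrow> 0 < d (chi_inv A g a)"
  by (rule d_pos[OF less_imp_le[OF chi_inv(1)]])

lemma phi_strict_mono:
  assumes "0 < a" "a < b"
  shows "phi A g a < phi A g b"
  unfolding phi_def using assms rate_strict_mono[OF assms] rate_pos[of a]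
  by (intro mult_strict_mono) auto

text \<open>In the variable \<open>R = chi_inv a\<close> surjectivity of \<open>phi\<close> becomes that of an explicit function
  of \<open>R\<close>, which is continuous because \<open>d\<close> is.\<close>

lemma phi_chi: "R > 0 \<Longrightarrow> phi A g (chi A g R) = (d R)\<^sup>2 / R"
  by (simp add: phi_def chi_inv_chi) (simp add: chi_def power2_eq_square)

lemma phi_bij: "bij_betw (phi A g) {0<..} {0<..}"
proof (rule bij_betw_imageI)
  show "inj_on (phi A g) {0<..}"
  proof (rule linorder_inj_onI')
    fix a b :: real assume "a \<in> {0<..}" "a < b"
    then show "phi A g a \<noteq> phi A g b" using phi_strict_mono[of a b] by simp
  qed
  have "\<exists>a>0. phi A g a = b" if b: "b > 0" for b
  proof -
    have "\<exists>R>0. (d R)\<^sup>2 / R = b"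
    proof (rule hyperbola_bounds_surj[OF _ _ _ _ b, of _ "(d 1)\<^sup>2" "(d 1)\<^sup>2"])
      show "continuous_on {0<..} (\<lambda>R. (d R)\<^sup>2 / R)"
        by (intro continuous_intros d_continuous) auto
      show "(d 1)\<^sup>2 > 0" using d_pos[of 1] by simp
      show "(d 1)\<^sup>2 / R \<le> (d R)\<^sup>2 / R" if "0 < R" "R \<le> 1" for R
        using dist_fun_antimono[of R 1 A g] that
        by (intro divide_right_mono power_mono) (auto simp: dist_fun_nonneg)
      show "(d R)\<^sup>2 / R \<le> (d 1)\<^sup>2 / R" if "1 \<le> R" for R
        using dist_fun_antimono[of 1 R A g] that
        by (intro divide_right_mono power_mono) (auto simp: dist_fun_nonneg)
    qed
    then show ?thesis using phi_chi chi_pos by (metis (no_types))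
  qed
  moreover have "phi A g a > 0" if "a > 0" for a
    using rate_pos that by (simp add: phi_def)
  ultimately have "phi A g ` {0<..} \<subseteq> {0<..}" "{0<..} \<subseteq> phi A g ` {0<..}"
    by (auto simp: image_iff Bex_def)
  then show "phi A g ` {0<..} = {0<..}" by (rule equalityI)
qed

lemma phi_inv:
  assumes "b > 0"
  shows "phi_inv A g b > 0" and "phi A g (phi_inv A g b) = b"
proof -
  have b: "b \<in> phi A g ` {0<..}" using bij_betw_imp_surj_on[OF phi_bij] assms by simp
  have inj: "inj_on (phi A g) {0<..}" using phi_bij by (rule bij_betw_imp_inj_on)
  show "phi A g (phi_inv A g b) = b"
    unfolding phi_inv_def by (rule f_the_inv_into_f[OF inj b])
  show "phi_inv A g b > 0"
    using the_inv_into_into[OF inj b order_refl] by (simp add: phi_inv_def)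
qed

text \<open>Since \<open>phi\<close> increases, \<open>\<delta> < phi (chi R)\<close> means \<open>chi_inv (phi_inv \<delta>) > R\<close>, so it suffices to pick
  \<open>R\<close> with \<open>d R\<close> small.\<close>

lemma rate_tendsto_zero:
  "((\<lambda>\<delta>. d (chi_inv A g (phi_inv A g \<delta>))) \<longlongrightarrow> 0) (at_right 0)"
proof (rule tendstoI)
  fix \<eta> :: real assume "\<eta> > 0"
  then obtain R where R: "R > 0" "d R < \<eta>" using d_arbitrarily_small by blast
  have b: "0 < phi A g (chi A g R)" using d_pos[of R] R by (simp add: phi_chi)
  have "dist (d (chi_inv A g (phi_inv A g \<delta>))) 0 < \<eta>"
    if \<delta>: "0 < \<delta>" "\<delta> < phi A g (chi A g R)" for \<delta>
  proof -
    have "phi_inv A g \<delta> < chi A g R"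
    proof (rule ccontr)
      assume "\<not> ?thesis"
      then have "phi A g (chi A g R) \<le> phi A g (phi_inv A g \<delta>)"
        using phi_strict_mono[of "chi A g R" "phi_inv A g \<delta>"] chi_pos[OF R(1)]
        by (cases "chi A g R = phi_inv A g \<delta>") auto
      then show False using phi_inv(2) \<delta> by simp
    qed
    then have "d (chi_inv A g (phi_inv A g \<delta>)) < d (chi_inv A g (chi A g R))"
      using phi_inv(1) \<delta> by (intro rate_strict_mono) auto
    then show ?thesis
      using R rate_pos[OF phi_inv(1)[OF \<delta>(1)]] by (simp add: chi_inv_chi)
  qed
  then show "\<forall>\<^sub>F \<delta> in at_right 0. dist (d (chi_inv A g (phi_inv A g \<delta>))) 0 < \<eta>"
    using eventually_at_right_real[OF b] by (auto elim!: eventually_mono)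
qed

text \<open>Rates and parameters are ordered alike: a rate below the one of \<open>\<eta>\<close> means a parameter below \<open>\<eta>\<close>.\<close>

lemma parameter_tendsto_zero:
  assumes a: "\<forall>\<^sub>F x in F. a x > 0" and lim: "((\<lambda>x. d (chi_inv A g (a x))) \<longlongrightarrow> 0) F"
  shows "(a \<longlongrightarrow> 0) F"
proof (rule tendstoI)
  fix \<eta> :: real assume \<eta>: "\<eta> > 0"
  have "\<forall>\<^sub>F x in F. d (chi_inv A g (a x)) < d (chi_inv A g \<eta>)"
    using order_tendstoD(2)[OF lim rate_pos[OF \<eta>]] .
  then show "\<forall>\<^sub>F x in F. dist (a x) 0 < \<eta>"
    using a
  proof eventually_elim
    case (elim x)
    then have "a x < \<eta>"
      using rate_strict_mono[of \<eta> "a x"] \<eta> by (cases \<eta> "a x" rule: linorder_cases) auto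
    then show ?case using elim by simp
  qed
qed

lemma eps_inv_eps:
  assumes "0 < c" "c < 1" "\<tau> > 0" "a > 0"
  shows "eps_inv A g c \<tau> (eps A g c \<tau> a) = a"
proof -
  have k: "(2 - c) / (1 - c) + \<tau> > 0" using assms by (simp add: add_pos_pos)
  have "inj_on (eps A g c \<tau>) {0<..}"
  proof (rule linorder_inj_onI')
    fix a b :: real assume "a \<in> {0<..}" "b \<in> {0<..}" "a < b"
    then show "eps A g c \<tau> a \<noteq> eps A g c \<tau> b"
      using rate_strict_mono[of a b] k not_in_range by (simp add: eps_def)
  qed
  then show ?thesis using assms by (simp add: eps_inv_def the_inv_into_f_f)
qed

end

section \<open>Convergence rates\<close>

lemma lavrentiev_error_exact_smoothing:
  fixes F :: "'a::real_inner \<Rightarrow> 'a" and A M :: "'a \<Rightarrow>\<^sub>L 'a"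
  assumes acc: "\<And>x. 0 \<le> blinfun_apply A x \<bullet> x" and \<alpha>: "\<alpha> > 0" and c: "c < 1"
    and x: "lavrentiev_solution F xbar \<alpha> yd x" and noise: "norm (y - yd) \<le> \<delta>"
    and M: "norm (M - id_blinfun) \<le> c"
    and Fx: "F x - y = blinfun_apply A (blinfun_apply M (x - xdag))"
    and w: "norm w \<le> R" "norm (xdag - xbar - blinfun_apply A w) \<le> D"
  shows "norm (x - xdag) \<le> 4 / (1 - c) * (\<alpha> * R + D + \<delta> / \<alpha>)"
proof -
  have "blinfun_apply A (blinfun_apply M (x - xdag)) + \<alpha> *\<^sub>R ((x - xdag) + (xdag - xbar)) = yd - y"
    using x by (simp add: lavrentiev_solution_def algebra_simps flip: Fx)
  from direct_error_bound[OF acc \<alpha> c M this, of w]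
  have "norm (x - xdag) \<le> 4 / (1 - c) *
      (\<alpha> * norm w + norm (yd - y) / \<alpha> + norm (xdag - xbar - blinfun_apply A w))" .
  also have "\<dots> \<le> 4 / (1 - c) * (\<alpha> * R + \<delta> / \<alpha> + D)"
    using c \<alpha> w noise
    by (intro mult_left_mono add_mono divide_right_mono) (auto simp: norm_minus_commute)
  finally show ?thesis by (simp add: algebra_simps)
qed

lemma lavrentiev_error_to_comparison:
  fixes F :: "'a::real_inner \<Rightarrow> 'a"
  assumes mono: "monotone_operator F" and \<alpha>: "\<alpha> > 0"
    and x: "lavrentiev_solution F xbar \<alpha> yd x" and noise: "norm (y - yd) \<le> \<delta>"
    and z: "b + \<alpha> *\<^sub>R (z - xbar) = 0"
    and rem: "norm (F z - y - b) \<le> \<nu>"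
  shows "norm (x - z) \<le> \<delta> / \<alpha> + \<nu> / \<alpha>"
proof -
  have eq: "yd - (F z + \<alpha> *\<^sub>R (z - xbar)) = (yd - y) - (F z - y - b)"
    using z by (simp add: algebra_simps add_eq_0_iff)
  have "\<alpha> * norm (x - z) \<le> norm ((yd - y) - (F z - y - b))"
    using lavrentiev_stability[OF mono \<alpha> x, of z] unfolding eq .
  also have "\<dots> \<le> \<delta> + \<nu>"
    using noise rem norm_triangle_ineq4[of "yd - y" "F z - y - b"]
    by (simp add: norm_minus_commute)
  finally show ?thesis using \<alpha> by (simp add: field_simps)
qed

text \<open>Both rate assertions are instances. \<open>R \<delta>\<close> and \<open>D \<delta>\<close> quantify the source condition: \<open>g\<close> is
  approximated up to \<open>D \<delta>\<close> by images of elements of norm at most \<open>R \<delta>\<close>, with a slack \<open>\<eta>\<close> so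
  that \<open>D \<delta>\<close> may be an infimum. The growth condition on the remainder concerns arguments
  up to the bound on the comparison element, and the convergence assumptions on \<open>\<alpha>\<close> bring the
  regularized solutions into the ball when \<open>N\<close> vanishes there.\<close>

lemma lavrentiev_rate:
  fixes F :: "'a::{real_inner,complete_space} \<Rightarrow> 'a" and A :: "'a \<Rightarrow>\<^sub>L 'a"
    and M :: "'a \<Rightarrow> 'a \<Rightarrow>\<^sub>L 'a" and R D r \<alpha> :: "real \<Rightarrow> real"
  assumes F: "hemicontinuous F" "monotone_operator F" "min_norm_solution F y xbar xdag"
    and acc: "\<And>x. 0 \<le> blinfun_apply A x \<bullet> x"
    and noise: "\<And>\<delta>. \<delta> > 0 \<Longrightarrow> norm (y - yd \<delta>) \<le> \<delta>"
    and \<alpha>: "\<And>\<delta>. \<delta> > 0 \<Longrightarrow> \<alpha> \<delta> > 0" "(\<alpha> \<longlongrightarrow> 0) (at_right 0)"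
      "((\<lambda>\<delta>. \<delta> / \<alpha> \<delta>) \<longlongrightarrow> 0) (at_right 0)"
    and x: "\<And>\<delta>. \<delta> > 0 \<Longrightarrow> lavrentiev_solution F xbar (\<alpha> \<delta>) (yd \<delta>) (x \<delta>)"
    and \<rho>: "\<rho> > 0" and c: "0 < c" "c < 1"
    and struct: "\<And>x. x \<in> ball xdag \<rho> \<Longrightarrow>
        F x - F xdag = blinfun_apply A (blinfun_apply (M x) (x - xdag)) + N x"
      "\<And>x. x \<in> ball xdag \<rho> \<Longrightarrow> norm (M x - id_blinfun) \<le> c"
      "\<And>x. x \<in> ball xdag \<rho> \<Longrightarrow> norm (N x) \<le> \<sigma> (norm (x - xdag))"
    and extra: "\<exists>x\<in>ball xdag \<rho>. N x \<noteq> 0 \<Longrightarrow>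
        (\<forall>x\<in>ball xdag \<rho>. \<forall>x'\<in>ball xdag \<rho>. norm (M x - M x') \<le> L * norm (x - x')) \<and>
        (\<forall>x\<in>ball xdag \<rho>. \<forall>h. 0 \<le> blinfun_apply A (blinfun_apply (M x) h) \<bullet> h) \<and>
        norm (xdag - xbar) \<le> (1 - c) * \<rho> \<and> c + \<rho> * L < 1"
    and source: "\<And>\<delta> \<eta>. \<delta> > 0 \<Longrightarrow> \<eta> > 0 \<Longrightarrow>
        \<exists>w. norm w \<le> R \<delta> \<and> norm (xdag - xbar - blinfun_apply A w) \<le> D \<delta> + \<eta>"
    and D: "\<And>\<delta>. \<delta> > 0 \<Longrightarrow> D \<delta> \<ge> 0"
    and rate: "\<And>\<delta>. \<delta> > 0 \<Longrightarrow> \<alpha> \<delta> * R \<delta> + D \<delta> + \<delta> / \<alpha> \<delta> \<le> K * r \<delta>"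
    and remainder: "\<And>\<delta> s. \<delta> > 0 \<Longrightarrow> 0 \<le> s \<Longrightarrow> s \<le> \<alpha> \<delta> * R \<delta> / (1 - c) + D \<delta> \<Longrightarrow>
        \<sigma> s \<le> \<alpha> \<delta> * (K' * r \<delta>)"
    and r: "\<And>\<delta>. \<delta> > 0 \<Longrightarrow> 0 \<le> r \<delta>"
  shows "(\<lambda>\<delta>. norm (x \<delta> - xdag)) \<in> O[at_right 0](r)"
proof -
  have Fdag: "F xdag = y" using F(3) by (simp add: min_norm_solution_def)
  have pos: "\<forall>\<^sub>F \<delta> in at_right (0::real). \<delta> > 0" by (simp add: eventually_at_right_less)
  show ?thesis
  proof (cases "\<exists>x\<in>ball xdag \<rho>. N x \<noteq> 0")
    case False
    have "(x \<longlongrightarrow> xdag) (at_right 0)"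
      by (rule lavrentiev_tendsto[OF F \<alpha> noise x])
    then have near: "\<forall>\<^sub>F \<delta> in at_right 0. dist (x \<delta>) xdag < \<rho>"
      using \<rho> by (rule tendstoD)
    show ?thesis
    proof (rule bigoI)
      show "\<forall>\<^sub>F \<delta> in at_right 0. norm (norm (x \<delta> - xdag)) \<le> (4 / (1 - c) * K) * norm (r \<delta>)"
        using near pos
      proof eventually_elim
        case (elim \<delta>)
        then have xb: "x \<delta> \<in> ball xdag \<rho>" by (simp add: dist_commute)
        have Fx: "F (x \<delta>) - y = blinfun_apply A (blinfun_apply (M (x \<delta>)) (x \<delta> - xdag))"
          using struct(1)[OF xb] False xb by (simp add: Fdag)
        have "norm (x \<delta> - xdag) * (1 - c) / 4 \<le> \<alpha> \<delta> * R \<delta> + D \<delta> + \<delta> / \<alpha> \<delta>"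
        proof (rule field_le_epsilon)
          fix \<eta> :: real assume "\<eta> > 0"
          then obtain w where w: "norm w \<le> R \<delta>"
              "norm (xdag - xbar - blinfun_apply A w) \<le> D \<delta> + \<eta>"
            using source elim by blast
          have "norm (x \<delta> - xdag) \<le> 4 / (1 - c) * (\<alpha> \<delta> * R \<delta> + (D \<delta> + \<eta>) + \<delta> / \<alpha> \<delta>)"
            using elim by (intro lavrentiev_error_exact_smoothing[OF acc \<alpha>(1) c(2) x noise
                  struct(2)[OF xb] Fx w])
          then show "norm (x \<delta> - xdag) * (1 - c) / 4 \<le> \<alpha> \<delta> * R \<delta> + D \<delta> + \<delta> / \<alpha> \<delta> + \<eta>"
            using c by (simp add: field_simps)
        qed
        also have "\<dots> \<le> K * r \<delta>" using rate elim by blast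
        finally show ?case using c r elim by (simp add: field_simps)
      qed
    qed
  next
    case True
    note extra = extra[OF True]
    have "norm (xdag - xbar) < \<rho>"
    proof -
      have "norm (xdag - xbar) \<le> (1 - c) * \<rho>" using extra by blast
      also have "\<dots> < \<rho>" using c \<rho> by (simp add: algebra_simps)
      finally show ?thesis .
    qed
    then have S: "cball xdag (norm (xdag - xbar)) \<subseteq> ball xdag \<rho>" by auto
    show ?thesis
    proof (rule bigoI)
      show "\<forall>\<^sub>F \<delta> in at_right 0. norm (norm (x \<delta> - xdag)) \<le> (K / (1 - c) + K') * norm (r \<delta>)"
        using pos
      proof eventually_elim
        case (elim \<delta>)
        note a = \<alpha>(1)[OF elim]
        have "\<exists>z\<in>cball xdag (norm (xdag - xbar)).
            blinfun_apply A (blinfun_apply (M z) (z - xdag)) + \<alpha> \<delta> *\<^sub>R (z - xdag + (xdag - xbar)) = 0"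
          using extra struct(2) c
          by (intro comparison_element_exists[OF acc a c(2) \<rho> _ _ _ _ _ S, of _ L]) auto
        then obtain z where z: "z \<in> ball xdag \<rho>" and z_eq:
            "blinfun_apply A (blinfun_apply (M z) (z - xdag)) + \<alpha> \<delta> *\<^sub>R (z - xdag + (xdag - xbar)) = 0"
          using S by blast
        define E where "E = norm (z - xdag)"
        have E: "E \<le> \<alpha> \<delta> * R \<delta> / (1 - c) + D \<delta>"
        proof (rule field_le_epsilon)
          fix \<eta> :: real assume "\<eta> > 0"
          then obtain w where w: "norm w \<le> R \<delta>"
              "norm (xdag - xbar - blinfun_apply A w) \<le> D \<delta> + \<eta>"
            using source elim by blast
          have AM: "0 \<le> blinfun_apply A (blinfun_apply (M z) h) \<bullet> h" for h
            using extra z by blast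
          have "E \<le> \<alpha> \<delta> * norm w / (1 - c) + norm (xdag - xbar - blinfun_apply A w)"
            unfolding E_def by (rule comparison_element_bound[OF acc a c(2) struct(2)[OF z] AM z_eq])
          moreover have "\<alpha> \<delta> * norm w / (1 - c) \<le> \<alpha> \<delta> * R \<delta> / (1 - c)"
            using w a c by (intro divide_right_mono mult_left_mono) auto
          ultimately show "E \<le> \<alpha> \<delta> * R \<delta> / (1 - c) + D \<delta> + \<eta>" using w by linarith
        qed
        have "norm (N z) \<le> \<alpha> \<delta> * (K' * r \<delta>)"
          using struct(3)[OF z] remainder[OF elim _ E] by (simp add: E_def)
        then have "norm (x \<delta> - z) \<le> \<delta> / \<alpha> \<delta> + \<alpha> \<delta> * (K' * r \<delta>) / \<alpha> \<delta>"
          using z_eq struct(1)[OF z]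
          by (intro lavrentiev_error_to_comparison[OF F(2) a x[OF elim] noise[OF elim],
                of "blinfun_apply A (blinfun_apply (M z) (z - xdag))"]) (auto simp: Fdag)
        then have "norm (x \<delta> - z) \<le> \<delta> / \<alpha> \<delta> + K' * r \<delta>" using a by simp
        then have 1: "norm (x \<delta> - xdag)
            \<le> \<delta> / \<alpha> \<delta> + K' * r \<delta> + (\<alpha> \<delta> * R \<delta> / (1 - c) + D \<delta>)"
          using E norm_triangle_ineq[of "x \<delta> - z" "z - xdag"] by (simp add: E_def)
        have "(\<delta> / \<alpha> \<delta> + D \<delta>) * (1 - c) \<le> (\<delta> / \<alpha> \<delta> + D \<delta>) * 1"
          using a elim D[OF elim] c by (intro mult_left_mono) auto
        then have "\<delta> / \<alpha> \<delta> + D \<delta> \<le> (\<delta> / \<alpha> \<delta> + D \<delta>) / (1 - c)"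
          using c by (simp add: pos_le_divide_eq)
        then have "\<delta> / \<alpha> \<delta> + \<alpha> \<delta> * R \<delta> / (1 - c) + D \<delta>
            \<le> (\<alpha> \<delta> * R \<delta> + D \<delta> + \<delta> / \<alpha> \<delta>) / (1 - c)"
          by (simp add: add_divide_distrib)
        also have "\<dots> \<le> K * r \<delta> / (1 - c)"
          using rate[OF elim] c by (intro divide_right_mono) auto
        finally show ?case using 1 r[OF elim] by (simp add: algebra_simps)
      qed
    qed
  qed
qed

text \<open>Along the segment from \<open>xdag\<close> to \<open>z\<close> a Gateaux derivative is an ordinary derivative of a curve,
  so the mean value inequality applies.\<close>

lemma gateaux_lipschitz_remainder:
  fixes F :: "'a::real_normed_vector \<Rightarrow> 'a"
  assumes deriv: "\<And>x. gateaux_derivative F x (F' x)"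
    and lip: "\<And>x. x \<in> ball xdag \<rho> \<Longrightarrow> norm (F' x - F' xdag) \<le> L * norm (x - xdag)"
    and z: "z \<in> ball xdag \<rho>"
  shows "norm (F z - F xdag - blinfun_apply (F' xdag) (z - xdag)) \<le> L * (norm (z - xdag))\<^sup>2"
proof -
  define h where "h = z - xdag"
  define f where "f = (\<lambda>t::real. F (xdag + t *\<^sub>R h))"
  have h: "norm h < \<rho>" using z by (simp add: h_def dist_norm norm_minus_commute)
  have "0 \<le> norm (F' z - F' xdag)" by simp
  then have Lh: "0 \<le> L * norm h" using lip[OF z] unfolding h_def by linarith
  have f': "(f has_vector_derivative blinfun_apply (F' (xdag + t *\<^sub>R h)) h) (at t within {0..1})" for t
  proof -
    have dF: "((\<lambda>s::real. F ((xdag + t *\<^sub>R h) + s *\<^sub>R h)) has_vector_derivative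
        blinfun_apply (F' (xdag + t *\<^sub>R h)) h) (at (t - t))"
      using deriv by (simp add: gateaux_derivative_def)
    have shift: "((\<lambda>s. s - t) has_vector_derivative 1) (at t)"
      by (auto intro!: derivative_eq_intros)
    have "((\<lambda>s. F ((xdag + t *\<^sub>R h) + (s - t) *\<^sub>R h)) has_vector_derivative
        blinfun_apply (F' (xdag + t *\<^sub>R h)) h) (at t)"
      using vector_diff_chain_at[OF shift dF] by (simp add: o_def)
    moreover have "(xdag + t *\<^sub>R h) + (s - t) *\<^sub>R h = xdag + s *\<^sub>R h" for s
      by (simp add: scaleR_left_diff_distrib)
    ultimately show ?thesis
      unfolding f_def by (simp add: has_vector_derivative_at_within)
  qed
  have bound: "norm (blinfun_apply (F' (xdag + t *\<^sub>R h)) h - blinfun_apply (F' (xdag + 0 *\<^sub>R h)) h)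
      \<le> L * norm h * norm h" if t: "t \<in> {0..1}" for t
  proof -
    have th: "norm (t *\<^sub>R h) \<le> norm h" using t by (simp add: mult_left_le_one_le)
    then have "xdag + t *\<^sub>R h \<in> ball xdag \<rho>" using h by (simp add: dist_norm)
    from lip[OF this] have "norm (F' (xdag + t *\<^sub>R h) - F' xdag) \<le> t * (L * norm h)"
      using t by (simp add: mult.left_commute)
    also have "\<dots> \<le> L * norm h" using t Lh by (simp add: mult_left_le_one_le)
    finally have "norm (F' (xdag + t *\<^sub>R h) - F' xdag) * norm h \<le> L * norm h * norm h"
      by (intro mult_right_mono) auto
    then show ?thesis
      using norm_blinfun[of "F' (xdag + t *\<^sub>R h) - F' xdag" h] by (simp add: blinfun.diff_left)
  qed
  have "norm (f 1 - f 0 - (1 - 0) *\<^sub>R blinfun_apply (F' (xdag + 0 *\<^sub>R h)) h)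
      \<le> norm (1 - 0 :: real) * (L * norm h * norm h)"
    by (rule vector_differentiable_bound_linearization[OF f' _ bound]) (auto simp: closed_segment_eq_real_ivl)
  then show ?thesis by (simp add: f_def h_def power2_eq_square mult.assoc)
qed

text \<open>With the derivative frozen at \<open>xdag\<close> the comparison element solves a linear equation, and
  \<open>g = A w\<close> gives \<open>\<parallel>z - xdag\<parallel> \<le> \<alpha> \<parallel>w\<parallel>\<close>. So \<open>z\<close> lies in the ball for small \<open>\<alpha>\<close>, and its quadratic
  remainder, divided by \<open>\<alpha>\<close>, is of order \<open>\<alpha>\<close>.\<close>

lemma lavrentiev_rate_gateaux:
  fixes F :: "'a::{real_inner,complete_space} \<Rightarrow> 'a" and \<alpha> :: "real \<Rightarrow> real"
  assumes mono: "monotone_operator F" and sol: "F xdag = y"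
    and noise: "\<And>\<delta>. \<delta> > 0 \<Longrightarrow> norm (y - yd \<delta>) \<le> \<delta>"
    and \<alpha>: "\<And>\<delta>. \<delta> > 0 \<Longrightarrow> \<alpha> \<delta> > 0" "(\<alpha> \<longlongrightarrow> 0) (at_right 0)"
    and \<alpha>_rate: "\<And>\<delta>. \<delta> > 0 \<Longrightarrow> \<alpha> \<delta> \<le> K * r \<delta>" "\<And>\<delta>. \<delta> > 0 \<Longrightarrow> \<delta> / \<alpha> \<delta> \<le> K * r \<delta>"
    and x: "\<And>\<delta>. \<delta> > 0 \<Longrightarrow> lavrentiev_solution F xbar (\<alpha> \<delta>) (yd \<delta>) (x \<delta>)"
    and \<rho>: "\<rho> > 0"
    and deriv: "\<And>x. gateaux_derivative F x (F' x)"
    and lip: "\<And>x. x \<in> ball xdag \<rho> \<Longrightarrow> norm (F' x - F' xdag) \<le> L * norm (x - xdag)"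
    and acc: "\<And>h. 0 \<le> blinfun_apply (F' xdag) h \<bullet> h"
    and w: "xdag - xbar = blinfun_apply (F' xdag) w"
    and r: "\<And>\<delta>. \<delta> > 0 \<Longrightarrow> 0 \<le> r \<delta>"
  shows "(\<lambda>\<delta>. norm (x \<delta> - xdag)) \<in> O[at_right 0](r)"
proof (rule bigoI)
  let ?A = "F' xdag"
  define C where "C = norm w + \<bar>L\<bar> * (norm w)\<^sup>2"
  have C: "C \<ge> 0" by (simp add: C_def)
  have pos: "\<forall>\<^sub>F \<delta> in at_right (0::real). \<delta> > 0" by (simp add: eventually_at_right_less)
  have "((\<lambda>\<delta>. \<alpha> \<delta> * norm w) \<longlongrightarrow> 0 * norm w) (at_right 0)"
    by (intro tendsto_intros \<alpha>)
  then have small: "\<forall>\<^sub>F \<delta> in at_right 0. \<alpha> \<delta> * norm w < \<rho>"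
    using \<rho> by (intro order_tendstoD(2)) auto
  show "\<forall>\<^sub>F \<delta> in at_right 0. norm (norm (x \<delta> - xdag)) \<le> (K + C * K) * norm (r \<delta>)"
    using small pos
  proof eventually_elim
    case (elim \<delta>)
    note a = \<alpha>(1)[OF elim(2)]
    obtain e where e: "blinfun_apply ?A e + \<alpha> \<delta> *\<^sub>R e = blinfun_apply ?A (- (\<alpha> \<delta> *\<^sub>R w))"
      using accretive_resolvent_exists[OF acc a] by blast
    have "(1 - 0) * norm e \<le> norm (- (\<alpha> \<delta> *\<^sub>R w))"
      using e by (intro resolvent_of_smoothed_bound[OF acc a, of id_blinfun 0]) auto
    then have en: "norm e \<le> \<alpha> \<delta> * norm w" using a by simp
    define z where "z = xdag + e"
    have zb: "z \<in> ball xdag \<rho>" using en elim(1) by (simp add: z_def dist_norm)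
    have z_eq: "blinfun_apply ?A e + \<alpha> \<delta> *\<^sub>R (z - xbar) = 0"
    proof -
      have "z - xbar = e + blinfun_apply ?A w" using w by (simp add: z_def algebra_simps)
      then have "blinfun_apply ?A e + \<alpha> \<delta> *\<^sub>R (z - xbar)
          = (blinfun_apply ?A e + \<alpha> \<delta> *\<^sub>R e) + \<alpha> \<delta> *\<^sub>R blinfun_apply ?A w"
        by (simp only: scaleR_add_right add.assoc)
      then show ?thesis by (simp add: e blinfun.minus_right blinfun.scaleR_right)
    qed
    have "norm (F z - y - blinfun_apply ?A e) \<le> L * (norm e)\<^sup>2"
      using gateaux_lipschitz_remainder[OF deriv lip zb] by (simp add: sol z_def)
    also have "\<dots> \<le> \<bar>L\<bar> * (\<alpha> \<delta> * norm w)\<^sup>2"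
      using en by (intro mult_mono power_mono) auto
    finally have "norm (x \<delta> - z) \<le> \<delta> / \<alpha> \<delta> + \<bar>L\<bar> * (\<alpha> \<delta> * norm w)\<^sup>2 / \<alpha> \<delta>"
      by (rule lavrentiev_error_to_comparison[OF mono a x[OF elim(2)] noise[OF elim(2)] z_eq])
    also have "\<bar>L\<bar> * (\<alpha> \<delta> * norm w)\<^sup>2 / \<alpha> \<delta> = \<bar>L\<bar> * (norm w)\<^sup>2 * \<alpha> \<delta>"
      using a by (simp add: power2_eq_square)
    finally have "norm (x \<delta> - xdag) \<le> \<delta> / \<alpha> \<delta> + C * \<alpha> \<delta>"
      using en norm_triangle_ineq[of "x \<delta> - z" e] by (simp add: C_def z_def algebra_simps)
    also have "\<dots> \<le> K * r \<delta> + C * (K * r \<delta>)"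
      using \<alpha>_rate elim C by (intro add_mono mult_left_mono) auto
    finally show ?case using r[OF elim(2)] by (simp add: algebra_simps)
  qed
qed

theorem theorem8:
  fixes F :: "'a::{real_inner, complete_space} \<Rightarrow> 'a"
    and y xbar xdag g :: 'a
    and A :: "'a \<Rightarrow>\<^sub>L 'a"
    and \<tau> :: real
    and \<alpha> :: "real \<Rightarrow> real"
    and yd xreg :: "real \<Rightarrow> 'a"
  assumes infinite_dim: "\<not> (\<exists>B::'a set. finite B \<and> span B = UNIV)"
    and separable: "separable_space (euclidean :: 'a topology)"
    and "hemicontinuous F"
    and "monotone_operator F"
    and "min_norm_solution F y xbar xdag"
    and g: "g = xdag - xbar"
    and "\<forall>x. 0 \<le> blinfun_apply A x \<bullet> x"
    and "closure (range (blinfun_apply A)) = UNIV"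
    and "\<tau> > 1"
    and "\<forall>\<delta>>0. norm (y - yd \<delta>) \<le> \<delta>"
    and "\<forall>\<delta>>0. \<alpha> \<delta> > 0"
    and "\<forall>\<delta>>0. lavrentiev_solution F xbar (\<alpha> \<delta>) (yd \<delta>) (xreg \<delta>)"
    and "g \<notin> range (blinfun_apply A) \<Longrightarrow>
           \<forall>\<delta>>0. \<delta> \<le> \<tau> * phi A g (\<alpha> \<delta>) \<and>
             dist_fun A g (chi_inv A g (\<alpha> \<delta>)) \<le> \<tau> * dist_fun A g (chi_inv A g (phi_inv A g \<delta>))"
    and "g \<in> range (blinfun_apply A) \<Longrightarrow>
           \<forall>\<delta>>0. 1 / \<tau> * \<delta> \<le> (\<alpha> \<delta>)\<^sup>2 \<and> (\<alpha> \<delta>)\<^sup>2 \<le> \<tau> * \<delta>"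
  shows
    "(\<forall>(\<rho>::real) (c::real) (\<sigma>::real \<Rightarrow> real) (M::'a \<Rightarrow> 'a \<Rightarrow>\<^sub>L 'a) (N::'a \<Rightarrow> 'a) (C\<^sub>\<sigma>::real) (L\<^sub>M::real).
        \<rho> > 0 \<and> 0 < c \<and> c < 1 \<and>
        mono_on {0..} \<sigma> \<and> (\<forall>e\<ge>0. 0 \<le> \<sigma> e) \<and>
        (\<forall>x\<in>ball xdag \<rho>.
            F x - F xdag = blinfun_apply A (blinfun_apply (M x) (x - xdag)) + N x \<and>
            norm (M x - id_blinfun) \<le> c \<and>
            norm (N x) \<le> \<sigma> (norm (x - xdag))) \<and>
        C\<^sub>\<sigma> > 0 \<and>
        (\<forall>e\<in>eps A g c \<tau> ` {0<..}. \<sigma> e \<le> C\<^sub>\<sigma> * e * eps_inv A g c \<tau> e) \<and>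
        ((\<exists>x\<in>ball xdag \<rho>. N x \<noteq> 0) \<longrightarrow>
            (\<forall>x\<in>ball xdag \<rho>. \<forall>x'\<in>ball xdag \<rho>. norm (M x - M x') \<le> L\<^sub>M * norm (x - x')) \<and>
            (\<forall>x\<in>ball xdag \<rho>. \<forall>h. 0 \<le> blinfun_apply A (blinfun_apply (M x) h) \<bullet> h) \<and>
            norm (xdag - xbar) \<le> (1 - c) * \<rho> \<and>
            c + \<rho> * L\<^sub>M < 1)
        \<longrightarrow>
        (g \<notin> range (blinfun_apply A) \<longrightarrow>
           (\<lambda>\<delta>. norm (xreg \<delta> - xdag)) \<in>
             O[at_right 0](\<lambda>\<delta>. dist_fun A g (chi_inv A g (phi_inv A g \<delta>)))) \<and>
        (g \<in> range (blinfun_apply A) \<longrightarrow>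
           (\<lambda>\<delta>. norm (xreg \<delta> - xdag)) \<in> O[at_right 0](\<lambda>\<delta>. sqrt \<delta>)))
     \<and>
     (\<forall>(F'::'a \<Rightarrow> 'a \<Rightarrow>\<^sub>L 'a) (\<rho>::real) (L::real).
        \<rho> > 0 \<and>
        (\<forall>x. gateaux_derivative F x (F' x)) \<and>
        (\<forall>x\<in>ball xdag \<rho>. norm (F' x - F' xdag) \<le> L * norm (x - xdag)) \<and>
        A = F' xdag \<and> g \<in> range (blinfun_apply A)
        \<longrightarrow>
        (\<lambda>\<delta>. norm (xreg \<delta> - xdag)) \<in> O[at_right 0](\<lambda>\<delta>. sqrt \<delta>))"
proof -
  note hemi = assms(3) and mono = assms(4) and sol = assms(5) and acc = assms(7)[rule_format]
    and dense = assms(8) and tau = assms(9) and noise = assms(10)[rule_format]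
    and \<alpha>_pos = assms(11)[rule_format] and lav = assms(12)[rule_format]
  have Fdag: "F xdag = y" using sol by (simp add: min_norm_solution_def)
  have pos: "\<forall>\<^sub>F \<delta> in at_right (0::real). \<delta> > 0" by (simp add: eventually_at_right_less)
  have sqrt_lim: "(sqrt \<longlongrightarrow> 0) (at_right 0)"
    using tendsto_real_sqrt[OF tendsto_ident_at, of 0 "{0<..}"] by simp

  have range_rates: "\<alpha> \<delta> \<le> sqrt \<tau> * sqrt \<delta>" "\<delta> / \<alpha> \<delta> \<le> \<tau> * \<alpha> \<delta>"
    if "g \<in> range (blinfun_apply A)" and \<delta>: "\<delta> > 0" for \<delta>
  proof -
    have bal: "1 / \<tau> * \<delta> \<le> (\<alpha> \<delta>)\<^sup>2" "(\<alpha> \<delta>)\<^sup>2 \<le> \<tau> * \<delta>" using assms(14) that by auto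
    show "\<alpha> \<delta> \<le> sqrt \<tau> * sqrt \<delta>"
      using real_le_rsqrt[OF bal(2)] by (simp add: real_sqrt_mult)
    have "\<delta> \<le> \<tau> * \<alpha> \<delta> * \<alpha> \<delta>"
      using bal(1) tau by (simp add: field_simps power2_eq_square)
    then show "\<delta> / \<alpha> \<delta> \<le> \<tau> * \<alpha> \<delta>" using \<alpha>_pos[OF \<delta>] by (simp add: pos_divide_le_eq)
  qed
  have range_rates': "\<delta> / \<alpha> \<delta> \<le> \<tau> * sqrt \<tau> * sqrt \<delta>"
    if "g \<in> range (blinfun_apply A)" and "\<delta> > 0" for \<delta>
    using order_trans[OF range_rates(2)[OF that] mult_left_mono[OF range_rates(1)[OF that], of \<tau>]]
      tau by (simp add: mult.assoc)
  have null: "(f \<longlongrightarrow> 0) (at_right 0)"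
    if "\<And>\<delta>. \<delta> > 0 \<Longrightarrow> 0 \<le> f \<delta>" "\<And>\<delta>. \<delta> > 0 \<Longrightarrow> f \<delta> \<le> K * r \<delta>" "(r \<longlongrightarrow> 0) (at_right 0)"
    for f r :: "real \<Rightarrow> real" and K
  proof (rule Lim_null_comparison)
    show "\<forall>\<^sub>F \<delta> in at_right 0. norm (f \<delta>) \<le> K * r \<delta>"
      using pos by (rule eventually_mono) (use that in simp)
    show "((\<lambda>\<delta>. K * r \<delta>) \<longlongrightarrow> 0) (at_right 0)"
      using tendsto_mult[OF tendsto_const[of K] that(3)] by simp
  qed
  have range_lim: "(\<alpha> \<longlongrightarrow> 0) (at_right 0)" "((\<lambda>\<delta>. \<delta> / \<alpha> \<delta>) \<longlongrightarrow> 0) (at_right 0)"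
    if "g \<in> range (blinfun_apply A)"
  proof -
    show "(\<alpha> \<longlongrightarrow> 0) (at_right 0)"
      using range_rates(1)[OF that] \<alpha>_pos sqrt_lim by (intro null[of \<alpha>]) (auto intro: less_imp_le)
    show "((\<lambda>\<delta>. \<delta> / \<alpha> \<delta>) \<longlongrightarrow> 0) (at_right 0)"
      using range_rates'[OF that] \<alpha>_pos sqrt_lim
      by (intro null[of "\<lambda>\<delta>. \<delta> / \<alpha> \<delta>"]) (auto intro: less_imp_le)
  qed

  show ?thesis
  proof (rule conjI; intro allI impI; elim conjE)
    fix \<rho> c :: real and \<sigma> :: "real \<Rightarrow> real" and M :: "'a \<Rightarrow> 'a \<Rightarrow>\<^sub>L 'a" and N :: "'a \<Rightarrow> 'a"
      and C\<^sub>\<sigma> L\<^sub>M :: real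
    assume \<rho>: "\<rho> > 0" and c: "0 < c" "c < 1" and \<sigma>_mono: "mono_on {0..} \<sigma>"
      and struct: "\<forall>x\<in>ball xdag \<rho>.
            F x - F xdag = blinfun_apply A (blinfun_apply (M x) (x - xdag)) + N x \<and>
            norm (M x - id_blinfun) \<le> c \<and> norm (N x) \<le> \<sigma> (norm (x - xdag))"
      and C: "C\<^sub>\<sigma> > 0"
      and \<sigma>: "\<forall>e\<in>eps A g c \<tau> ` {0<..}. \<sigma> e \<le> C\<^sub>\<sigma> * e * eps_inv A g c \<tau> e"
      and extra: "(\<exists>x\<in>ball xdag \<rho>. N x \<noteq> 0) \<longrightarrow>
            (\<forall>x\<in>ball xdag \<rho>. \<forall>x'\<in>ball xdag \<rho>. norm (M x - M x') \<le> L\<^sub>M * norm (x - x')) \<and>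
            (\<forall>x\<in>ball xdag \<rho>. \<forall>h. 0 \<le> blinfun_apply A (blinfun_apply (M x) h) \<bullet> h) \<and>
            norm (xdag - xbar) \<le> (1 - c) * \<rho> \<and> c + \<rho> * L\<^sub>M < 1"
    have \<sigma>_below: "\<sigma> s \<le> C\<^sub>\<sigma> * e * a"
      if "0 \<le> s" "s \<le> e" "e = eps A g c \<tau> a" "eps_inv A g c \<tau> e = a" "a > 0" for s e a
    proof -
      have "\<sigma> s \<le> \<sigma> e" using \<sigma>_mono that(1,2) by (auto intro: mono_onD)
      also have "\<dots> \<le> C\<^sub>\<sigma> * e * a" using bspec[OF \<sigma>, of e] that(3-5) by simp
      finally show ?thesis .
    qed
    note rate_rule = lavrentiev_rate[where M = M and N = N and \<sigma> = \<sigma>,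
        OF hemi mono sol acc noise \<alpha>_pos _ _ lav \<rho> c _ _ _ mp[OF extra]]
    show "(g \<notin> range (blinfun_apply A) \<longrightarrow>
           (\<lambda>\<delta>. norm (xreg \<delta> - xdag)) \<in>
             O[at_right 0](\<lambda>\<delta>. dist_fun A g (chi_inv A g (phi_inv A g \<delta>)))) \<and>
        (g \<in> range (blinfun_apply A) \<longrightarrow>
           (\<lambda>\<delta>. norm (xreg \<delta> - xdag)) \<in> O[at_right 0](\<lambda>\<delta>. sqrt \<delta>))"
    proof (intro conjI impI)
      assume nr: "g \<notin> range (blinfun_apply A)"
      interpret unattained_source A g using dense nr by unfold_locales
      let ?R = "\<lambda>\<delta>. chi_inv A g (\<alpha> \<delta>)"
      let ?r = "\<lambda>\<delta>. d (chi_inv A g (phi_inv A g \<delta>))"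
      have choice: "\<delta> \<le> \<tau> * phi A g (\<alpha> \<delta>)" "d (?R \<delta>) \<le> \<tau> * ?r \<delta>" if "\<delta> > 0" for \<delta>
        using assms(13)[OF nr] that by auto
      have D0: "0 < d (?R \<delta>)" if "\<delta> > 0" for \<delta> using rate_pos \<alpha>_pos that by blast
      have r0: "0 \<le> ?r \<delta>" if "\<delta> > 0" for \<delta> using rate_pos phi_inv(1) that by (simp add: less_imp_le)
      have noise_rate: "\<delta> / \<alpha> \<delta> \<le> \<tau> * d (?R \<delta>)" if "\<delta> > 0" for \<delta>
        using choice(1)[OF that] \<alpha>_pos[OF that] by (simp add: phi_def pos_divide_le_eq mult_ac)
      have D_lim: "((\<lambda>\<delta>. d (?R \<delta>)) \<longlongrightarrow> 0) (at_right 0)"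
        using choice(2) D0 rate_tendsto_zero
        by (intro null[of "\<lambda>\<delta>. d (?R \<delta>)"]) (auto intro: less_imp_le)
      have lim1: "(\<alpha> \<longlongrightarrow> 0) (at_right 0)"
        by (rule parameter_tendsto_zero[OF eventually_mono[OF pos \<alpha>_pos] D_lim])
      have lim2: "((\<lambda>\<delta>. \<delta> / \<alpha> \<delta>) \<longlongrightarrow> 0) (at_right 0)"
        using noise_rate \<alpha>_pos D_lim
        by (intro null[of "\<lambda>\<delta>. \<delta> / \<alpha> \<delta>"]) (auto intro: less_imp_le)
      \<comment> \<open>The factor in \<open>eps\<close>; it exceeds \<open>1 / (1 - c) + 1\<close>, which comes from the comparison element.\<close>
      define k where "k = (2 - c) / (1 - c) + \<tau>"
      have k: "k > 0" "(2 - c) / (1 - c) \<le> k" using c tau by (auto simp: k_def intro: add_pos_pos)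
      show "(\<lambda>\<delta>. norm (xreg \<delta> - xdag)) \<in> O[at_right 0](?r)"
      proof (rule rate_rule[OF _ _ lim1 lim2, where R = ?R and D = "\<lambda>\<delta>. d (?R \<delta>)"
            and K = "(2 + \<tau>) * \<tau>" and K' = "C\<^sub>\<sigma> * k * \<tau>" and r = ?r])
        fix \<delta> \<eta> :: real assume \<delta>: "\<delta> > 0" "\<eta> > 0"
        then have "0 \<le> ?R \<delta>" using chi_inv(1)[OF \<alpha>_pos] by (simp add: less_imp_le)
        from dist_fun_near[OF this, of A g "d (?R \<delta>) + \<eta>"]
        show "\<exists>w. norm w \<le> ?R \<delta> \<and> norm (xdag - xbar - blinfun_apply A w) \<le> d (?R \<delta>) + \<eta>"
          using \<delta> g by (auto intro: less_imp_le)
      next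
        fix \<delta> :: real assume \<delta>: "\<delta> > 0"
        have "\<alpha> \<delta> * ?R \<delta> + d (?R \<delta>) + \<delta> / \<alpha> \<delta> \<le> (2 + \<tau>) * d (?R \<delta>)"
          using noise_rate[OF \<delta>] chi_inv_balance[OF \<alpha>_pos[OF \<delta>]] by (simp add: algebra_simps)
        also have "\<dots> \<le> (2 + \<tau>) * (\<tau> * ?r \<delta>)"
          using choice(2)[OF \<delta>] tau by (intro mult_left_mono) auto
        finally show "\<alpha> \<delta> * ?R \<delta> + d (?R \<delta>) + \<delta> / \<alpha> \<delta> \<le> ((2 + \<tau>) * \<tau>) * ?r \<delta>"
          by (simp add: mult.assoc)
      next
        fix \<delta> s :: real
        assume \<delta>: "\<delta> > 0" and s: "0 \<le> s" "s \<le> \<alpha> \<delta> * ?R \<delta> / (1 - c) + d (?R \<delta>)"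
        have "\<alpha> \<delta> * ?R \<delta> / (1 - c) + d (?R \<delta>) = (2 - c) / (1 - c) * d (?R \<delta>)"
          using c unfolding chi_inv_balance[OF \<alpha>_pos[OF \<delta>]] by (simp add: field_simps)
        also have "\<dots> \<le> k * d (?R \<delta>)" using k D0[OF \<delta>] by (intro mult_right_mono) auto
        finally have "s \<le> k * d (?R \<delta>)" using s by linarith
        then have "\<sigma> s \<le> C\<^sub>\<sigma> * (k * d (?R \<delta>)) * \<alpha> \<delta>"
          using s eps_inv_eps[OF c _ \<alpha>_pos[OF \<delta>], of \<tau>] tau nr \<alpha>_pos[OF \<delta>]
          by (intro \<sigma>_below) (auto simp: eps_def k_def)
        also have "\<dots> \<le> C\<^sub>\<sigma> * (k * (\<tau> * ?r \<delta>)) * \<alpha> \<delta>"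
          using choice(2)[OF \<delta>] k C \<alpha>_pos[OF \<delta>] by (intro mult_right_mono mult_left_mono) auto
        finally show "\<sigma> s \<le> \<alpha> \<delta> * ((C\<^sub>\<sigma> * k * \<tau>) * ?r \<delta>)" by (simp add: mult_ac)
      qed (use struct r0 D0 in \<open>auto intro: less_imp_le\<close>)
    next
      assume rg: "g \<in> range (blinfun_apply A)"
      then obtain w where w: "g = blinfun_apply A w" by blast
      have the_w: "(THE w. g = blinfun_apply A w) = w"
        using accretive_dense_range_inj[OF acc dense] w by (intro the_equality) auto
      define k where "k = norm w / (1 - c) + \<tau>"
      have k: "k > 0" "norm w / (1 - c) \<le> k" using c tau by (auto simp: k_def intro: add_nonneg_pos)
      have eps: "eps A g c \<tau> a = k * a" for a
        unfolding eps_def the_w k_def using rg by simp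
      have eps_inv: "eps_inv A g c \<tau> (k * a) = a" if "a > 0" for a
      proof -
        have "inj_on (eps A g c \<tau>) {0<..}" using k by (auto simp: inj_on_def eps)
        from the_inv_into_f_f[OF this, of a] show ?thesis using that by (simp add: eps_inv_def eps)
      qed
      show "(\<lambda>\<delta>. norm (xreg \<delta> - xdag)) \<in> O[at_right 0](sqrt)"
      proof (rule rate_rule[OF _ _ range_lim[OF rg], where R = "\<lambda>_. norm w" and D = "\<lambda>_. 0"
            and K = "(norm w + \<tau>) * sqrt \<tau>" and K' = "C\<^sub>\<sigma> * k * sqrt \<tau>" and r = sqrt])
        show "\<exists>v. norm v \<le> norm w \<and> norm (xdag - xbar - blinfun_apply A v) \<le> 0 + \<eta>"
          if "\<delta> > 0" "\<eta> > 0" for \<delta> \<eta> :: real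
          using that w g by (intro exI[of _ w]) auto
      next
        fix \<delta> :: real assume \<delta>: "\<delta> > 0"
        have "\<alpha> \<delta> * norm w + \<delta> / \<alpha> \<delta> \<le> (norm w + \<tau>) * \<alpha> \<delta>"
          using range_rates(2)[OF rg \<delta>] by (simp add: algebra_simps)
        also have "\<dots> \<le> (norm w + \<tau>) * (sqrt \<tau> * sqrt \<delta>)"
          using range_rates(1)[OF rg \<delta>] tau by (intro mult_left_mono) auto
        finally show "\<alpha> \<delta> * norm w + 0 + \<delta> / \<alpha> \<delta> \<le> ((norm w + \<tau>) * sqrt \<tau>) * sqrt \<delta>"
          by (simp add: mult.assoc)
      next
        fix \<delta> s :: real
        assume \<delta>: "\<delta> > 0" and s: "0 \<le> s" "s \<le> \<alpha> \<delta> * norm w / (1 - c) + 0"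
        have "\<alpha> \<delta> * norm w / (1 - c) \<le> k * \<alpha> \<delta>"
          using mult_right_mono[OF k(2), of "\<alpha> \<delta>"] \<alpha>_pos[OF \<delta>] by (simp add: mult.commute)
        then have "\<sigma> s \<le> C\<^sub>\<sigma> * (k * \<alpha> \<delta>) * \<alpha> \<delta>"
          using s eps_inv \<alpha>_pos[OF \<delta>] by (intro \<sigma>_below) (auto simp: eps)
        also have "\<dots> \<le> C\<^sub>\<sigma> * (k * (sqrt \<tau> * sqrt \<delta>)) * \<alpha> \<delta>"
          using range_rates(1)[OF rg \<delta>] k C \<alpha>_pos[OF \<delta>]
          by (intro mult_right_mono mult_left_mono) auto
        finally show "\<sigma> s \<le> \<alpha> \<delta> * ((C\<^sub>\<sigma> * k * sqrt \<tau>) * sqrt \<delta>)" by (simp add: mult_ac)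
      qed (use struct in auto)
    qed
  next
    fix F' :: "'a \<Rightarrow> 'a \<Rightarrow>\<^sub>L 'a" and \<rho> L :: real
    assume \<rho>: "\<rho> > 0" and deriv: "\<forall>x. gateaux_derivative F x (F' x)"
      and lip: "\<forall>x\<in>ball xdag \<rho>. norm (F' x - F' xdag) \<le> L * norm (x - xdag)"
      and A: "A = F' xdag" and rg: "g \<in> range (blinfun_apply A)"
    obtain w where w: "xdag - xbar = blinfun_apply (F' xdag) w"
      using rg unfolding g A by (rule imageE)
    have K: "\<alpha> \<delta> \<le> (\<tau> * sqrt \<tau>) * sqrt \<delta>" if "\<delta> > 0" for \<delta>
    proof -
      have "1 * (sqrt \<tau> * sqrt \<delta>) \<le> \<tau> * (sqrt \<tau> * sqrt \<delta>)"
        using tau that by (intro mult_right_mono) auto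
      then show ?thesis using range_rates(1)[OF rg that] by (simp add: mult.assoc)
    qed
    show "(\<lambda>\<delta>. norm (xreg \<delta> - xdag)) \<in> O[at_right 0](sqrt)"
      by (rule lavrentiev_rate_gateaux[OF mono Fdag noise \<alpha>_pos range_lim(1)[OF rg] K
            range_rates'[OF rg] lav \<rho> deriv[rule_format] lip[rule_format] acc[unfolded A] w]) auto
  qed
qed

end
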